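(* Let $1\le q<p$, let $\Phi\in L^p(\Omega\times E;H)$ be such that $\Phi=0$ $\mathbb P\otimes\mu$-almost everywhere on $\Omega\times B^c$ for some $B\in\mathcal E_0$, and let $F\in L^{q'}(\Omega;H)$ with $q':=\frac q{q-1}$ (where $\frac10:=\infty$). Then $\langle F,\delta(\Phi)\rangle\in L^1(\Omega;\mathbb R)$, $\langle DF,\Phi\rangle\in L^1(\Omega\times E;\mathbb R)$, and $$\mathbb E\langle F,\delta(\Phi)\rangle=\mathbb E\int_B\langle D_xF,\Phi(x)\rangle\,\mu(\mathrm dx).$$
   Context: Setting: $(E,\mathcal E,\mu)$ is a $\sigma$-finite measure space such that the diagonal $\{(x,y)\in E\times E:x=y\}$ belongs to $\mathcal E\otimes\mathcal E$; $\mathcal E_0:=\{B\in\mathcal E:\mu(B)<\infty\}$. $\mathbf N$ is the space of all $\sigma$-finite $\mathbb N_0\cup\{+\infty\}$-valued measures on $(E,\mathcal E)$ with the $\sigma$-algebra $\mathcal N$ generated by the maps $\eta\mapsto\eta(B)$, $B\in\mathcal E$. $(\Omega,\mathcal F,\mathbb P)$ is a complete probability space, $N:\Omega\to\mathbf N$ is a Poisson random measure with intensity measure $\mu$, represented as $N=\sum_{n=1}^{N(E)}\delta_{X_n}$ with $E$-valued random variables $X_1,X_2,\dots$, and $\mathcal F$ is the $\mathbb P$-completion of $\sigma(N)$. $H$ is a separable real Hilbert space with inner product $\langle\cdot,\cdot\rangle$ and norm $\|\cdot\|$. $L^0(\cdot;H)$ denotes equivalence classes of strongly measurable functions and $L^p(\cdot;H)$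 the usual Bochner spaces; product spaces carry product measures ($\Omega$ carries $\mathbb P$, $E$ carries $\mu$). Difference operator: $D:L^0(\Omega;H)\to L^0(\Omega\times E;H)$, $D_xF:=f(N+\delta_x)-f(N)$, where $f:\mathbf N\to H$ is measurable with $F=f(N)$ $\mathbb P$-a.s.; this is $\mathbb P\otimes\mu$-a.e. independent of the choice of $f$. Operator $\varepsilon^-$: for $\eta\in\mathbf N$, $\eta\setminus\delta_x:=\eta-\delta_x$ if $\eta(B)\ge\delta_x(B)$ for all $B\in\mathcal E$, and $\eta\setminus\delta_x:=\eta$ otherwise. For $\Phi\in L^0(\Omega\times E;H)$ with $\Phi(x)=\varphi(N,x)$ $\mathbb P\otimes\mu$-a.e., $\varphi:\mathbf N\times E\to H$ measurable, $\varepsilon_x^-\Phi(x):=\varphi(N\setminus\delta_x,x)$; this is $\mathbb P\otimes N$-a.e. independent of $\varphi$, where $(\mathbb P\otimes N)(\mathrm d\omega,\mathrm dx)=N(\omega,\mathrm dx)\mathbb P(\mathrm d\omega)$. Pathwise Kabanov–Skorohod integral: $\delta:L^1(\Omega\times E;H)\to L^1(\Omega;H)$, $\delta(\Phi):=\int_E\varepsilon_x^-\Phi(x)\,N(\mathrm dx)-\int_E\Phi(x)\,\mu(\mathrm dx)$ (a.s. defined $H$-valued Bochner integrals). Under the hypotheses, $\Phi\in L^1(\Omega\times E;H)$, so $\delta(\Phi)$ is defined. *)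

theory Defs
  imports "HOL-Probability.Probability"
begin

text \<open>The space of all sigma-finite measures with values in the natural numbers and infinity,
  with the sigma-algebra generated by the evaluation maps (compare \<^const>\<open>subprob_algebra\<close>).\<close>

definition counting_measures :: "'e measure \<Rightarrow> 'e measure measure" where
  "counting_measures \<mu> =
    (SUP B \<in> sets \<mu>. vimage_algebra
       {\<eta>. sets \<eta> = sets \<mu> \<and> sigma_finite_measure \<eta> \<and>
            (\<forall>A\<in>sets \<mu>. emeasure \<eta> A = \<infinity> \<or> (\<exists>k. emeasure \<eta> A = of_nat k))}
       (\<lambda>\<eta>. emeasure \<eta> B) borel)"

definition measurable_diagonal :: "'e measure \<Rightarrow> bool" where
  "measurable_diagonal \<mu> \<longleftrightarrow> {(x, y) \<in> space \<mu> \<times> space \<mu>. x = y} \<in> sets (\<mu> \<Otimes>\<^sub>M \<mu>)"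

definition poisson_law :: "'w measure \<Rightarrow> ('w \<Rightarrow> ennreal) \<Rightarrow> ennreal \<Rightarrow> bool" where
  "poisson_law M Y m \<longleftrightarrow>
    (if m = \<infinity> then (AE \<omega> in M. Y \<omega> = \<infinity>)
     else (\<forall>k. measure M {\<omega> \<in> space M. Y \<omega> = of_nat k} =
                 exp (- enn2real m) * enn2real m ^ k / fact k))"

definition poisson_random_measure ::
    "'w measure \<Rightarrow> 'e measure \<Rightarrow> ('w \<Rightarrow> 'e measure) \<Rightarrow> bool" where
  "poisson_random_measure M \<mu> N \<longleftrightarrow>
    N \<in> M \<rightarrow>\<^sub>M counting_measures \<mu> \<and>
    (\<forall>B\<in>sets \<mu>. poisson_law M (\<lambda>\<omega>. emeasure (N \<omega>) B) (emeasure \<mu> B)) \<and>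
    (\<forall>(A :: nat \<Rightarrow> 'e set) n. A ` {..<n} \<subseteq> sets \<mu> \<longrightarrow> disjoint_family_on A {..<n} \<longrightarrow>
       prob_space.indep_vars M (\<lambda>_. borel) (\<lambda>i \<omega>. emeasure (N \<omega>) (A i)) {..<n})"

text \<open>Almost surely, \<open>N\<close> is the sum of the unit masses at its first \<open>k\<close> points, where
  \<open>k\<close> is the mass of the whole space. The sequence of points is indexed from 0.\<close>

definition point_representation ::
    "'w measure \<Rightarrow> 'e measure \<Rightarrow> ('w \<Rightarrow> 'e measure) \<Rightarrow> (nat \<Rightarrow> 'w \<Rightarrow> 'e) \<Rightarrow> bool" where
  "point_representation M \<mu> N X \<longleftrightarrow>
    (\<forall>n. X n \<in> M \<rightarrow>\<^sub>M \<mu>) \<and>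
    (AE \<omega> in M. \<forall>B\<in>sets \<mu>. emeasure (N \<omega>) B =
       (\<Sum>n. if of_nat n < emeasure (N \<omega>) (space \<mu>)
             then emeasure (return \<mu> (X n \<omega>)) B else 0))"

text \<open>The sigma-algebra of \<open>M\<close> is the completion of the one generated by \<open>N\<close>.\<close>

definition completely_generated_by ::
    "'w measure \<Rightarrow> 'e measure \<Rightarrow> ('w \<Rightarrow> 'e measure) \<Rightarrow> bool" where
  "completely_generated_by M \<mu> N \<longleftrightarrow>
    sets M = sets (completion (restr_to_subalg M
                     (vimage_algebra (space M) N (counting_measures \<mu>))))"

text \<open>Elements of Bochner spaces are given by representatives. The spaces of values considered
  are separable, so strong measurability is Borel measurability.\<close>

definition Lp :: "ennreal \<Rightarrow> 'a measure \<Rightarrow>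
    ('a \<Rightarrow> 'h::{real_normed_vector, second_countable_topology}) set" where
  "Lp p M = {f \<in> borel_measurable M.
     if p = \<infinity> then (\<exists>C. AE x in M. norm (f x) \<le> C)
     else (\<integral>\<^sup>+x. ennreal (norm (f x) powr enn2real p) \<partial>M) < \<infinity>}"

definition add_point :: "'e measure \<Rightarrow> 'e measure \<Rightarrow> 'e \<Rightarrow> 'e measure" where
  "add_point \<mu> \<eta> x =
    measure_of (space \<mu>) (sets \<mu>) (\<lambda>B. emeasure \<eta> B + emeasure (return \<mu> x) B)"

definition remove_point :: "'e measure \<Rightarrow> 'e measure \<Rightarrow> 'e \<Rightarrow> 'e measure" where
  "remove_point \<mu> \<eta> x =
    (if \<forall>B\<in>sets \<mu>. emeasure (return \<mu> x) B \<le> emeasure \<eta> B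
     then diff_measure \<eta> (return \<mu> x) else \<eta>)"

text \<open>The difference operator and the operator \<open>\<epsilon>\<^sup>-\<close> below are defined through some
  representative \<open>f\<close> or \<open>\<phi>\<close> as a measurable function of \<open>N\<close>. Different representatives give
  almost everywhere equal results.\<close>

definition difference ::
    "'w measure \<Rightarrow> 'e measure \<Rightarrow> ('w \<Rightarrow> 'e measure) \<Rightarrow>
     ('w \<Rightarrow> 'h::{real_inner, banach, second_countable_topology}) \<Rightarrow> 'w \<times> 'e \<Rightarrow> 'h" where
  "difference M \<mu> N F =
    (let f = (SOME f. f \<in> borel_measurable (counting_measures \<mu>) \<and>
                      (AE \<omega> in M. F \<omega> = f (N \<omega>)))
     in (\<lambda>(\<omega>, x). f (add_point \<mu> (N \<omega>) x) - f (N \<omega>)))"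

definition eps_minus ::
    "'w measure \<Rightarrow> 'e measure \<Rightarrow> ('w \<Rightarrow> 'e measure) \<Rightarrow>
     ('w \<times> 'e \<Rightarrow> 'h::{real_inner, banach, second_countable_topology}) \<Rightarrow> 'w \<times> 'e \<Rightarrow> 'h" where
  "eps_minus M \<mu> N \<Phi> =
    (let \<phi> = (SOME \<phi>. \<phi> \<in> borel_measurable (counting_measures \<mu> \<Otimes>\<^sub>M \<mu>) \<and>
                      (AE (\<omega>, x) in M \<Otimes>\<^sub>M \<mu>. \<Phi> (\<omega>, x) = \<phi> (N \<omega>, x)))
     in (\<lambda>(\<omega>, x). \<phi> (remove_point \<mu> (N \<omega>) x, x)))"

definition kabanov_skorohod ::
    "'w measure \<Rightarrow> 'e measure \<Rightarrow> ('w \<Rightarrow> 'e measure) \<Rightarrow>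
     ('w \<times> 'e \<Rightarrow> 'h::{real_inner, banach, second_countable_topology}) \<Rightarrow> 'w \<Rightarrow> 'h" where
  "kabanov_skorohod M \<mu> N \<Phi> \<omega> =
    (LINT x|N \<omega>. eps_minus M \<mu> N \<Phi> (\<omega>, x)) - (LINT x|\<mu>. \<Phi> (\<omega>, x))"

end

theory Submission
  imports Defs
begin

text \<open>
  The duality is Mecke's equation for the Poisson random measure. Write \<open>F = f(N)\<close> and
  \<open>\<Phi> = \<phi>(N, \<cdot>)\<close>. Almost surely \<open>N\<close> is the sum of the unit masses at its points \<open>X\<^sub>n\<close>, so the
  integral of \<open>\<epsilon>\<^sup>-\<Phi>\<close> against \<open>N\<close> is the sum of \<open>\<phi>(N - \<delta>\<^bsub>X\<^sub>n\<^esub>, X\<^sub>n)\<close> over the points. Since adding \<open>X\<^sub>n\<close>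
  back to \<open>N - \<delta>\<^bsub>X\<^sub>n\<^esub>\<close> returns \<open>N\<close>, the inner product of \<open>F\<close> with this sum is the sum of
  \<open>h(N - \<delta>\<^bsub>X\<^sub>n\<^esub>, X\<^sub>n)\<close> for \<open>h(\<eta>, x) = \<langle>f(\<eta> + \<delta>\<^sub>x), \<phi>(\<eta>, x)\<rangle>\<close>. Its expectation is the integral of \<open>h(N, x)\<close>
  over \<open>M \<otimes> \<mu>\<close>, that is, of \<open>\<langle>f(N + \<delta>\<^sub>x), \<Phi>(x)\<rangle>\<close>. Subtracting the expectation of
  \<open>\<langle>F, \<integral>\<Phi> d\<mu>\<rangle>\<close> leaves the integral of \<open>\<langle>D\<^sub>xF, \<Phi>(x)\<rangle>\<close>; this is \<open>pathwise_duality\<close>.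

  The form of Mecke's equation behind this computation is \<open>reduced_mecke\<close>: the reduced Campbell
  measure, which counts the pairs \<open>(N - \<delta>\<^bsub>X\<^sub>n\<^esub>, X\<^sub>n)\<close>, is the product of the law of \<open>N\<close> and \<open>\<mu>\<close>. The reduced
  form suits a space of measures that are \<open>\<sigma>\<close>-finite without a common exhausting sequence:
  adding a point is jointly measurable in the measure and the point, while points are removed only
  along the measurable sequence \<open>X\<^sub>n\<close>, so that joint measurability of the removal is never at
  stake. To prove it, one compares both measures on cylinders. The masses of finitely many sets are
  sums of the masses of disjoint atoms, these are independent, and a Poisson variable
  \<open>Y\<close> of mean \<open>m\<close> satisfies \<open>E[Y; Y - 1 \<in> T] = m P(Y \<in> T)\<close> (\<open>poisson_law_size_bias\<close>).

  The strict inequality \<open>q < p\<close> gives integrability. By Mecke's equation, the \<open>r\<close>-th moment of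
  \<open>f(N + \<delta>\<^sub>x)\<close> over \<open>\<Omega> \<times> B\<close> is the expectation of \<open>N(B) \<parallel>F\<parallel>\<^sup>r\<close>. As \<open>N(B)\<close> is unbounded, this need not be
  finite for \<open>r = q'\<close>, but all moments of \<open>N(B)\<close> are finite and so it is for every
  \<open>r < q'\<close>. Exponents \<open>s < p\<close> and \<open>t < q'\<close> can be chosen such that the exponent \<open>r\<close> conjugate to
  \<open>s\<close> is below \<open>t\<close>, and Young's inequality then bounds all inner products.
\<close>

section \<open>The space of counting measures\<close>

lemma space_counting_measures:
  "space (counting_measures \<mu>) =
    {\<eta>. sets \<eta> = sets \<mu> \<and> sigma_finite_measure \<eta> \<and>
         (\<forall>A\<in>sets \<mu>. emeasure \<eta> A = \<infinity> \<or> (\<exists>k. emeasure \<eta> A = of_nat k))}"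
  by (auto simp: counting_measures_def space_Sup_eq_UN)

lemma counting_measures_eq:
  "counting_measures \<mu> =
    (SUP C \<in> sets \<mu>. vimage_algebra (space (counting_measures \<mu>)) (\<lambda>\<eta>. emeasure \<eta> C) borel)"
  by (simp only: space_counting_measures) (rule counting_measures_def)

lemma counting_measuresD:
  assumes "\<eta> \<in> space (counting_measures \<mu>)"
  shows "sets \<eta> = sets \<mu>" "space \<eta> = space \<mu>" "sigma_finite_measure \<eta>"
    "\<And>A. A \<in> sets \<mu> \<Longrightarrow> emeasure \<eta> A = \<infinity> \<or> (\<exists>k. emeasure \<eta> A = of_nat k)"
  using assms by (auto simp: space_counting_measures dest: sets_eq_imp_space_eq)

lemma measurable_emeasure_counting_measures [measurable]:
  "A \<in> sets \<mu> \<Longrightarrow> (\<lambda>\<eta>. emeasure \<eta> A) \<in> borel_measurable (counting_measures \<mu>)"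
  by (auto intro!: measurable_Sup1 measurable_vimage_algebra1 simp: counting_measures_def)

lemma measurable_counting_measures:
  assumes "\<And>x. x \<in> space S \<Longrightarrow> f x \<in> space (counting_measures \<mu>)"
    and "\<And>A. A \<in> sets \<mu> \<Longrightarrow> (\<lambda>x. emeasure (f x) A) \<in> borel_measurable S"
  shows "f \<in> S \<rightarrow>\<^sub>M counting_measures \<mu>"
  using assms
  by (subst counting_measures_eq) (auto intro!: measurable_Sup2 measurable_vimage_algebra2)

lemma sets_counting_measures:
  "sets (counting_measures \<mu>) =
    sigma_sets (space (counting_measures \<mu>))
      {{\<eta> \<in> space (counting_measures \<mu>). emeasure \<eta> C \<in> T} |C T. C \<in> sets \<mu> \<and> T \<in> sets borel}"
  (is "_ = sigma_sets ?\<Omega> ?G")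
proof -
  let ?V = "\<lambda>C. vimage_algebra ?\<Omega> (\<lambda>\<eta>. emeasure \<eta> C) borel"
  have "sets (counting_measures \<mu>) = sigma_sets ?\<Omega> (\<Union>m\<in>?V ` sets \<mu>. sets m)"
    by (subst counting_measures_eq, rule sets_Sup_eq) auto
  also have "(\<Union>m\<in>?V ` sets \<mu>. sets m) = ?G"
  proof -
    have "sets (?V C) = {{\<eta> \<in> ?\<Omega>. emeasure \<eta> C \<in> T} |T. T \<in> sets borel}" for C
      by (simp add: sets_vimage_algebra2 vimage_def Int_def conj_commute)
    then show ?thesis by auto
  qed
  finally show ?thesis .
qed

lemma sets_add_point [simp]: "sets (add_point \<mu> \<eta> x) = sets \<mu>"
  and space_add_point [simp]: "space (add_point \<mu> \<eta> x) = space \<mu>"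
  by (auto simp: add_point_def)

lemma emeasure_add_point:
  assumes "\<eta> \<in> space (counting_measures \<mu>)" "A \<in> sets \<mu>"
  shows "emeasure (add_point \<mu> \<eta> x) A = emeasure \<eta> A + indicator A x"
proof -
  note [simp] = counting_measuresD[OF assms(1)]
  have "emeasure (add_point \<mu> \<eta> x) A = emeasure \<eta> A + emeasure (return \<mu> x) A"
    unfolding add_point_def
  proof (rule emeasure_measure_of_sigma)
    show "countably_additive (sets \<mu>) (\<lambda>B. emeasure \<eta> B + emeasure (return \<mu> x) B)"
      by (auto simp: countably_additive_def suminf_add[symmetric] suminf_emeasure simp del: emeasure_return)
  qed (use assms in \<open>auto simp: positive_def sets.sigma_algebra_axioms\<close>)
  with assms show ?thesis by simp
qed

lemma add_point_in_counting_measures: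
  assumes "\<eta> \<in> space (counting_measures \<mu>)"
  shows "add_point \<mu> \<eta> x \<in> space (counting_measures \<mu>)"
proof -
  note \<eta> = counting_measuresD[OF assms]
  obtain \<A> where \<A>: "countable \<A>" "\<A> \<subseteq> sets \<mu>" "\<Union>\<A> = space \<mu>" "\<forall>a\<in>\<A>. emeasure \<eta> a \<noteq> \<infinity>"
    using sigma_finite_measure.sigma_finite_countable[OF \<eta>(3)] \<eta>(1,2) by auto
  have "sigma_finite_measure (add_point \<mu> \<eta> x)"
    using \<A> by (intro sigma_finite_measure.intro exI[of _ \<A>])
      (auto simp: emeasure_add_point[OF assms] subset_eq split: split_indicator)
  moreover have "emeasure \<eta> A + indicator A x = \<infinity> \<or> (\<exists>k. emeasure \<eta> A + indicator A x = of_nat k)"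
    if A: "A \<in> sets \<mu>" for A
    using \<eta>(4)[OF A]
  proof
    assume "\<exists>k. emeasure \<eta> A = of_nat k"
    then obtain k where "emeasure \<eta> A = of_nat k" by auto
    then have "emeasure \<eta> A + indicator A x = of_nat (k + indicator A x)"
      by (simp split: split_indicator)
    then show ?thesis by blast
  qed simp
  ultimately show ?thesis
    by (auto simp: space_counting_measures emeasure_add_point[OF assms])
qed

text \<open>Only the masses of single sets have to be measured, and these are sums of a function of \<open>\<eta>\<close> and a
  function of \<open>x\<close>; this is why adding a point needs no uniform \<open>\<sigma>\<close>-finiteness.\<close>

lemma measurable_add_point [measurable]:
  "(\<lambda>(\<eta>, x). add_point \<mu> \<eta> x) \<in> counting_measures \<mu> \<Otimes>\<^sub>M \<mu> \<rightarrow>\<^sub>M counting_measures \<mu>"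
proof (rule measurable_counting_measures)
  fix A assume A [measurable]: "A \<in> sets \<mu>"
  have "(\<lambda>z. emeasure (fst z) A + indicator A (snd z)) \<in> borel_measurable (counting_measures \<mu> \<Otimes>\<^sub>M \<mu>)"
    by measurable
  then show "(\<lambda>z. emeasure (case z of (\<eta>, x) \<Rightarrow> add_point \<mu> \<eta> x) A)
      \<in> borel_measurable (counting_measures \<mu> \<Otimes>\<^sub>M \<mu>)"
    by (rule measurable_cong[THEN iffD1, rotated])
      (auto simp: space_pair_measure emeasure_add_point A)
qed (auto simp: space_pair_measure add_point_in_counting_measures)

lemma
  assumes \<eta>: "\<eta> \<in> space (counting_measures \<mu>)"
    and x: "\<And>A. A \<in> sets \<mu> \<Longrightarrow> indicator A x \<le> emeasure \<eta> A"
  shows emeasure_remove_point: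
      "A \<in> sets \<mu> \<Longrightarrow> emeasure (remove_point \<mu> \<eta> x) A = emeasure \<eta> A - indicator A x"
    and remove_point_in_counting_measures:
      "remove_point \<mu> \<eta> x \<in> space (counting_measures \<mu>)"
    and add_point_remove_point: "add_point \<mu> (remove_point \<mu> \<eta> x) x = \<eta>"
proof -
  note D = counting_measuresD[OF \<eta>]
  have R: "remove_point \<mu> \<eta> x =
      measure_of (space \<mu>) (sets \<mu>) (\<lambda>A. emeasure \<eta> A - emeasure (return \<mu> x) A)"
    using x by (auto simp: remove_point_def diff_measure_def D)
  have em: "emeasure (remove_point \<mu> \<eta> x) A = emeasure \<eta> A - indicator A x"
    if A: "A \<in> sets \<mu>" for A
  proof -
    have "emeasure (remove_point \<mu> \<eta> x) A = emeasure \<eta> A - emeasure (return \<mu> x) A"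
      unfolding R
    proof (rule emeasure_measure_of_sigma)
      show "countably_additive (sets \<mu>) (\<lambda>B. emeasure \<eta> B - emeasure (return \<mu> x) B)"
      proof (safe intro!: countably_additiveI)
        fix C :: "nat \<Rightarrow> _" assume C: "range C \<subseteq> sets \<mu>" "disjoint_family C" "(\<Union>i. C i) \<in> sets \<mu>"
        have "(\<Sum>i. emeasure \<eta> (C i) - emeasure (return \<mu> x) (C i)) + (\<Sum>i. emeasure (return \<mu> x) (C i))
            = (\<Sum>i. emeasure \<eta> (C i) - emeasure (return \<mu> x) (C i) + emeasure (return \<mu> x) (C i))"
          by (rule suminf_add) auto
        also have "\<dots> = (\<Sum>i. emeasure \<eta> (C i))"
          using C x by (intro suminf_cong diff_add_cancel_ennreal) (auto simp: subset_eq)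
        also have "\<dots> = emeasure \<eta> (\<Union>i. C i)"
          using C by (intro suminf_emeasure) (auto simp: D)
        also have "(\<Sum>i. emeasure (return \<mu> x) (C i)) = emeasure (return \<mu> x) (\<Union>i. C i)"
          using C by (intro suminf_emeasure) auto
        finally show "(\<Sum>i. emeasure \<eta> (C i) - emeasure (return \<mu> x) (C i)) =
            emeasure \<eta> (\<Union>i. C i) - emeasure (return \<mu> x) (\<Union>i. C i)"
          using C(3) by (metis emeasure_return ennreal_add_diff_cancel_right ennreal_indicator
              ennreal_neq_top infinity_ennreal_def)
      qed
    qed (use A in \<open>auto simp: positive_def sets.sigma_algebra_axioms D\<close>)
    with A show ?thesis by simp
  qed
  then show "A \<in> sets \<mu> \<Longrightarrow> emeasure (remove_point \<mu> \<eta> x) A = emeasure \<eta> A - indicator A x" .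
  have [simp]: "sets (remove_point \<mu> \<eta> x) = sets \<mu>" "space (remove_point \<mu> \<eta> x) = space \<mu>"
    by (simp_all add: R)
  show *: "remove_point \<mu> \<eta> x \<in> space (counting_measures \<mu>)"
  proof -
    obtain \<A> where \<A>: "countable \<A>" "\<A> \<subseteq> sets \<mu>" "\<Union>\<A> = space \<mu>" "\<forall>a\<in>\<A>. emeasure \<eta> a \<noteq> \<infinity>"
      using sigma_finite_measure.sigma_finite_countable[OF D(3)] D(1,2) by auto
    have "sigma_finite_measure (remove_point \<mu> \<eta> x)"
      using \<A> by (intro sigma_finite_measure.intro exI[of _ \<A>])
        (auto simp: em subset_eq ennreal_minus_eq_top)
    moreover have "emeasure \<eta> A - indicator A x = \<infinity> \<or> (\<exists>k. emeasure \<eta> A - indicator A x = of_nat k)"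
      if A: "A \<in> sets \<mu>" for A
      using D(4)[OF A]
    proof
      assume "\<exists>k. emeasure \<eta> A = of_nat k"
      then obtain k where k: "emeasure \<eta> A = of_nat k" by auto
      then have "emeasure \<eta> A - indicator A x = of_nat (k - indicator A x)"
        by (cases k) (auto split: split_indicator)
      then show ?thesis by blast
    qed (auto split: split_indicator)
    ultimately show ?thesis
      by (auto simp: space_counting_measures em)
  qed
  show "add_point \<mu> (remove_point \<mu> \<eta> x) x = \<eta>"
    using x by (intro measure_eqI)
      (auto simp: D emeasure_add_point[OF *] em diff_add_cancel_ennreal)
qed

section \<open>Factorization through a generating map\<close>

lemma AE_pair_measureI_fst:
  assumes "sigma_finite_measure M2" and "AE x in M1. P x"
  shows "AE z in M1 \<Otimes>\<^sub>M M2. P (fst z)"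
proof -
  interpret M2: sigma_finite_measure M2 by fact
  obtain Z where Z: "Z \<in> null_sets M1" "{x \<in> space M1. \<not> P x} \<subseteq> Z"
    using assms(2) unfolding eventually_ae_filter by auto
  have "Z \<times> space M2 \<in> null_sets (M1 \<Otimes>\<^sub>M M2)"
    using Z(1) by (auto simp: null_sets_def M2.emeasure_pair_measure_Times)
  then show ?thesis
    by (rule AE_I') (use Z(2) in \<open>auto simp: space_pair_measure\<close>)
qed

text \<open>The Doob--Dynkin factorization up to null sets. Simple functions factor because their level sets
  do, and the limit of the factors exists wherever the original functions converge; elsewhere \<open>lim\<close>
  supplies a measurable default.\<close>

lemma borel_measurable_AE_factor:
  fixes f :: "'x \<Rightarrow> 'h::{banach, second_countable_topology}"
  assumes sets: "\<And>A. A \<in> sets S \<Longrightarrow> \<exists>C\<in>sets R. AE x in S. x \<in> A \<longleftrightarrow> T x \<in> C"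
    and f: "f \<in> borel_measurable S"
  shows "\<exists>g\<in>borel_measurable R. AE x in S. f x = g (T x)"
proof -
  obtain s where s: "\<And>i. simple_function S (s i)" "\<And>x. x \<in> space S \<Longrightarrow> (\<lambda>i. s i x) \<longlonglongrightarrow> f x"
    using borel_measurable_implies_sequence_metric[OF f, of 0] by blast
  have "\<exists>g\<in>borel_measurable R. AE x in S. s i x = g (T x)" for i
  proof -
    let ?Y = "s i ` space S"
    have fin: "finite ?Y"
      using s(1) by (auto simp: simple_function_def)
    have "\<forall>y\<in>?Y. \<exists>C\<in>sets R. AE x in S. x \<in> s i -` {y} \<inter> space S \<longleftrightarrow> T x \<in> C"
      using s(1)[of i] by (intro ballI sets) (auto simp: simple_function_def)
    then obtain C where C: "\<And>y. y \<in> ?Y \<Longrightarrow> C y \<in> sets R"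
      "\<And>y. y \<in> ?Y \<Longrightarrow> AE x in S. x \<in> s i -` {y} \<inter> space S \<longleftrightarrow> T x \<in> C y"
      by metis
    let ?g = "\<lambda>t. \<Sum>y\<in>?Y. indicator (C y) t *\<^sub>R y"
    have "AE x in S. \<forall>y\<in>?Y. x \<in> s i -` {y} \<inter> space S \<longleftrightarrow> T x \<in> C y"
      using fin C(2) by (intro AE_finite_allI) auto
    then have "AE x in S. s i x = ?g (T x)"
      using AE_space
    proof eventually_elim
      case (elim x)
      then have "?g (T x) = (\<Sum>y\<in>?Y. if y = s i x then y else 0)"
        by (intro sum.cong) (auto simp: indicator_def)
      also have "\<dots> = s i x"
        using fin elim(2) by simp
      finally show ?case ..
    qed
    moreover have "?g \<in> borel_measurable R"
      using C(1) by (intro borel_measurable_sum borel_measurable_scaleR) auto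
    ultimately show ?thesis by (intro bexI[of _ ?g])
  qed
  then obtain g where g: "\<And>i. g i \<in> borel_measurable R" "\<And>i. AE x in S. s i x = g i (T x)"
    by metis
  have "AE x in S. \<forall>i. s i x = g i (T x)"
    using g(2) by (simp add: AE_all_countable)
  then have "AE x in S. f x = lim (\<lambda>i. g i (T x))"
    using AE_space
  proof eventually_elim
    case (elim x)
    with s(2)[of x] have "(\<lambda>i. g i (T x)) \<longlonglongrightarrow> f x" by simp
    then show ?case by (simp add: limI)
  qed
  moreover have "(\<lambda>t. lim (\<lambda>i. g i t)) \<in> borel_measurable R"
    using g(1) by simp
  ultimately show ?thesis by (intro bexI[of _ "\<lambda>t. lim (\<lambda>i. g i t)"])
qed

lemma completely_generated_sets:
  assumes gen: "completely_generated_by M \<mu> N"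
    and N: "N \<in> M \<rightarrow>\<^sub>M counting_measures \<mu>"
    and A: "A \<in> sets M"
  shows "\<exists>C\<in>sets (counting_measures \<mu>). AE \<omega> in M. \<omega> \<in> A \<longleftrightarrow> N \<omega> \<in> C"
proof -
  let ?V = "vimage_algebra (space M) N (counting_measures \<mu>)"
  let ?R = "restr_to_subalg M ?V"
  have sub: "subalgebra M ?V"
    using N by (simp add: subalgebra_def measurable_iff_sets)
  have "A \<in> sets (completion ?R)"
    using A gen by (simp add: completely_generated_by_def)
  then obtain S Z Z' where Z: "A = S \<union> Z" "Z \<subseteq> Z'" "Z' \<in> null_sets ?R" "S \<in> sets ?R"
    by (rule sets_completionE)
  have "N \<in> space M \<rightarrow> space (counting_measures \<mu>)"
    using N by (auto dest: measurable_space)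
  then obtain C where C: "C \<in> sets (counting_measures \<mu>)" "S = N -` C \<inter> space M"
    using Z(4) by (auto simp: sets_restr_to_subalg[OF sub] sets_vimage_algebra2)
  have "Z' \<in> null_sets M"
    using Z(3) by (simp add: null_sets_restr_to_subalg[OF sub])
  then have "AE \<omega> in M. \<omega> \<notin> Z'"
    by (rule AE_not_in)
  then have "AE \<omega> in M. \<omega> \<in> A \<longleftrightarrow> N \<omega> \<in> C"
    using AE_space by eventually_elim (use Z C in auto)
  then show ?thesis using C(1) by blast
qed

text \<open>The class of sets that agree almost everywhere with a preimage is a \<open>\<sigma>\<close>-algebra, and it contains
  the rectangles. Hence functions on \<open>M \<Otimes>\<^sub>M \<mu>\<close> factor through \<open>(N, x)\<close> too, although no completion of
  the product is involved.\<close>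

lemma completely_generated_pair_sets:
  assumes gen: "completely_generated_by M \<mu> N"
    and N [measurable]: "N \<in> M \<rightarrow>\<^sub>M counting_measures \<mu>"
    and \<mu>: "sigma_finite_measure \<mu>"
    and A: "A \<in> sets (M \<Otimes>\<^sub>M \<mu>)"
  shows "\<exists>C\<in>sets (counting_measures \<mu> \<Otimes>\<^sub>M \<mu>). AE z in M \<Otimes>\<^sub>M \<mu>. z \<in> A \<longleftrightarrow> (N (fst z), snd z) \<in> C"
  using A unfolding sets_pair_measure[of M \<mu>]
proof (induction rule: sigma_sets.induct)
  case (Basic A)
  then obtain a b where ab: "A = a \<times> b" "a \<in> sets M" "b \<in> sets \<mu>" by blast
  from completely_generated_sets[OF gen N ab(2)] obtain C where
    C: "C \<in> sets (counting_measures \<mu>)" "AE \<omega> in M. \<omega> \<in> a \<longleftrightarrow> N \<omega> \<in> C" by blast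
  have "AE z in M \<Otimes>\<^sub>M \<mu>. fst z \<in> a \<longleftrightarrow> N (fst z) \<in> C"
    by (rule AE_pair_measureI_fst[OF \<mu> C(2)])
  then have "AE z in M \<Otimes>\<^sub>M \<mu>. z \<in> A \<longleftrightarrow> (N (fst z), snd z) \<in> C \<times> b"
    by eventually_elim (auto simp: ab)
  then show ?case using C(1) ab(3) by (intro bexI[of _ "C \<times> b"]) auto
next
  case Empty
  show ?case by (rule bexI[of _ "{}"]) auto
next
  case (Compl A)
  then obtain C where C: "C \<in> sets (counting_measures \<mu> \<Otimes>\<^sub>M \<mu>)"
    "AE z in M \<Otimes>\<^sub>M \<mu>. z \<in> A \<longleftrightarrow> (N (fst z), snd z) \<in> C" by (elim bexE)
  from C(2) AE_space have "AE z in M \<Otimes>\<^sub>M \<mu>. z \<in> space M \<times> space \<mu> - A \<longleftrightarrow>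
      (N (fst z), snd z) \<in> space (counting_measures \<mu> \<Otimes>\<^sub>M \<mu>) - C"
    by eventually_elim (auto simp: space_pair_measure measurable_space[OF N])
  then show ?case using C(1) by (intro bexI[of _ "space (counting_measures \<mu> \<Otimes>\<^sub>M \<mu>) - C"]) auto
next
  case (Union A)
  then obtain C where C: "\<And>i. C i \<in> sets (counting_measures \<mu> \<Otimes>\<^sub>M \<mu>)"
    "\<And>i::nat. AE z in M \<Otimes>\<^sub>M \<mu>. z \<in> A i \<longleftrightarrow> (N (fst z), snd z) \<in> C i"
    unfolding Bex_def using choice[of "\<lambda>i C. C \<in> sets (counting_measures \<mu> \<Otimes>\<^sub>M \<mu>) \<and>
      (AE z in M \<Otimes>\<^sub>M \<mu>. z \<in> A i \<longleftrightarrow> (N (fst z), snd z) \<in> C)"] by auto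
  have "AE z in M \<Otimes>\<^sub>M \<mu>. \<forall>i. z \<in> A i \<longleftrightarrow> (N (fst z), snd z) \<in> C i"
    using C(2) by (simp add: AE_all_countable)
  then have "AE z in M \<Otimes>\<^sub>M \<mu>. z \<in> (\<Union>i. A i) \<longleftrightarrow> (N (fst z), snd z) \<in> (\<Union>i. C i)"
    by eventually_elim auto
  then show ?case using C(1) by (intro bexI[of _ "\<Union>i. C i"]) auto
qed

section \<open>The Poisson distribution\<close>

lemma poisson_law_nn_integral:
  assumes M: "prob_space M" and Y [measurable]: "Y \<in> borel_measurable M"
    and law: "poisson_law M Y (ennreal m)" and m: "0 \<le> m"
  shows "(\<integral>\<^sup>+\<omega>. g (Y \<omega>) \<partial>M) = (\<Sum>k. g (of_nat k) * ennreal (exp (- m) * m ^ k / fact k))"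
proof -
  interpret prob_space M by fact
  let ?S = "\<lambda>k. {\<omega> \<in> space M. Y \<omega> = of_nat k}"
  have em: "emeasure M (?S k) = ennreal (exp (- m) * m ^ k / fact k)" for k
    using law m by (simp add: poisson_law_def emeasure_eq_measure)
  have disj: "disjoint_family ?S"
    by (auto simp: disjoint_family_on_def)
  have sums: "(\<lambda>k. exp (- m) * m ^ k / fact k) sums (exp (- m) * exp m)"
    using sums_mult[OF exp_converges[of m], of "exp (- m)"] by (simp add: divide_inverse mult_ac)
  \<comment> \<open>The weights sum to one, so \<open>Y\<close> is almost surely a natural number and infinity has no mass.\<close>
  have "emeasure M (\<Union>k. ?S k) = (\<Sum>k. ennreal (exp (- m) * m ^ k / fact k))"
    using disj by (subst suminf_emeasure[symmetric]) (auto simp: em)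
  also have "\<dots> = ennreal (exp (- m) * exp m)"
    using sums m by (intro suminf_ennreal_eq) auto
  also have "\<dots> = 1"
    by (simp add: exp_minus)
  finally have "AE \<omega> in M. \<omega> \<in> (\<Union>k. ?S k)"
    by (intro AE_prob_1) (simp add: emeasure_eq_measure)
  then have "AE \<omega> in M. g (Y \<omega>) = (\<Sum>k. g (of_nat k) * indicator (?S k) \<omega>)"
  proof eventually_elim
    case (elim \<omega>)
    then obtain k where k: "\<omega> \<in> ?S k" by blast
    then have "(\<Sum>k. g (of_nat k) * indicator (?S k) \<omega>) = (\<Sum>j\<in>{k}. g (of_nat j) * indicator (?S j) \<omega>)"
      by (intro suminf_finite) (auto simp: indicator_def)
    with k show ?case by simp
  qed
  then have "(\<integral>\<^sup>+\<omega>. g (Y \<omega>) \<partial>M) = (\<integral>\<^sup>+\<omega>. (\<Sum>k. g (of_nat k) * indicator (?S k) \<omega>) \<partial>M)"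
    by (rule nn_integral_cong_AE)
  also have "\<dots> = (\<Sum>k. \<integral>\<^sup>+\<omega>. g (of_nat k) * indicator (?S k) \<omega> \<partial>M)"
    by (rule nn_integral_suminf) measurable
  also have "\<dots> = (\<Sum>k. g (of_nat k) * ennreal (exp (- m) * m ^ k / fact k))"
    by (simp add: nn_integral_cmult_indicator em)
  finally show ?thesis .
qed

text \<open>Size-biasing a Poisson variable shifts it by one, because
  \<open>k m\<^sup>k / k! = m m\<^sup>k\<^sup>-\<^sup>1 / (k - 1)!\<close>. This is Mecke's equation for a single set.\<close>

lemma poisson_law_size_bias:
  assumes M: "prob_space M" and Y [measurable]: "Y \<in> borel_measurable M"
    and law: "poisson_law M Y m" and m: "m < \<infinity>" and T [measurable]: "T \<in> sets borel"
  shows "(\<integral>\<^sup>+\<omega>. Y \<omega> * indicator T (Y \<omega> - 1) \<partial>M) = m * emeasure M {\<omega> \<in> space M. Y \<omega> \<in> T}"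
proof -
  obtain r where r: "m = ennreal r" "0 \<le> r" using m by (cases m) auto
  note int = poisson_law_nn_integral[OF M Y law[unfolded r(1)] r(2)]
  let ?w = "\<lambda>k. exp (- r) * r ^ k / fact k"
  have step: "of_nat (Suc k) * ennreal (?w (Suc k)) = ennreal r * ennreal (?w k)" for k
  proof -
    have "of_nat (Suc k) * ennreal (?w (Suc k)) = ennreal (real (Suc k) * ?w (Suc k))"
      unfolding ennreal_of_nat_eq_real_of_nat using r(2) by (intro ennreal_mult[symmetric]) auto
    also have "real (Suc k) * ?w (Suc k) = r * ?w k"
      by (simp add: fact_Suc del: of_nat_Suc)
    also have "ennreal (r * ?w k) = ennreal r * ennreal (?w k)"
      using r(2) by (intro ennreal_mult) auto
    finally show ?thesis .
  qed
  have "(\<integral>\<^sup>+\<omega>. Y \<omega> * indicator T (Y \<omega> - 1) \<partial>M) =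
      (\<Sum>k. of_nat k * indicator T (of_nat k - 1) * ennreal (?w k))"
    by (rule int[of "\<lambda>y. y * indicator T (y - 1)"])
  also have "\<dots> = (\<Sum>k. of_nat (k + 1) * indicator T (of_nat (k + 1) - 1) * ennreal (?w (k + 1)))"
    by (rule trans[OF suminf_offset[where i = 1]]) simp_all
  also have "\<dots> = (\<Sum>k. ennreal r * (indicator T (of_nat k) * ennreal (?w k)))"
  proof (rule suminf_cong)
    fix k
    have "of_nat (k + 1) - 1 = (of_nat k :: ennreal)"
      by (simp add: ennreal_of_nat_eq_real_of_nat ennreal_minus flip: ennreal_1)
    then have "of_nat (k + 1) * indicator T (of_nat (k + 1) - 1) * ennreal (?w (k + 1)) =
        indicator T (of_nat k) * (of_nat (Suc k) * ennreal (?w (Suc k)))"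
      unfolding Suc_eq_plus1 by (simp only: mult_ac)
    also have "\<dots> = ennreal r * (indicator T (of_nat k) * ennreal (?w k))"
      unfolding step by (simp only: mult_ac)
    finally show "of_nat (k + 1) * indicator T (of_nat (k + 1) - 1) * ennreal (?w (k + 1)) =
        ennreal r * (indicator T (of_nat k) * ennreal (?w k))" .
  qed
  also have "\<dots> = ennreal r * (\<Sum>k. indicator T (of_nat k) * ennreal (?w k))"
    by (rule ennreal_suminf_cmult)
  also have "(\<Sum>k. indicator T (of_nat k) * ennreal (?w k)) = (\<integral>\<^sup>+\<omega>. indicator T (Y \<omega>) \<partial>M)"
    by (rule int[of "indicator T", symmetric])
  also have "\<dots> = (\<integral>\<^sup>+\<omega>. indicator {\<omega> \<in> space M. Y \<omega> \<in> T} \<omega> \<partial>M)"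
    by (rule nn_integral_cong) (auto simp: indicator_def)
  also have "\<dots> = emeasure M {\<omega> \<in> space M. Y \<omega> \<in> T}"
    by simp
  finally show ?thesis by (simp add: r(1))
qed

lemma poisson_law_finite_moments:
  fixes s :: real
  assumes M: "prob_space M" and Y [measurable]: "Y \<in> borel_measurable M"
    and law: "poisson_law M Y m" and m: "m < \<infinity>" and s: "0 < s"
  shows "(\<integral>\<^sup>+\<omega>. ennreal (enn2real (Y \<omega>) powr s) \<partial>M) < \<infinity>" and "AE \<omega> in M. Y \<omega> < \<infinity>"
proof -
  obtain r where r: "m = ennreal r" "0 \<le> r" using m by (cases m) auto
  note int = poisson_law_nn_integral[OF M Y law[unfolded r(1)] r(2)]
  let ?w = "\<lambda>k. exp (- r) * r ^ k / fact k"
  \<comment> \<open>From \<open>ln x \<le> x\<close> at \<open>x = k / s\<close>: powers are dominated by an exponential, whose Poisson mean is finite.\<close>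
  have bound: "real k powr s \<le> s powr s * exp 1 ^ k" for k :: nat
  proof (cases "k = 0")
    case False
    have "ln (real k / s) \<le> real k / s"
      using False s by (intro less_imp_le ln_less_self) auto
    then have "s * (ln k - ln s) \<le> k"
      using False s by (simp add: ln_div field_simps)
    then have "exp (s * ln k) \<le> exp (s * ln s + k)"
      by (simp add: algebra_simps)
    also have "\<dots> = s powr s * exp 1 ^ k"
      using s by (simp add: powr_def exp_add exp_of_nat_mult[symmetric])
    finally show ?thesis using False by (simp add: powr_def)
  qed (use s in auto)
  have sums: "(\<lambda>k. s powr s * exp (- r) * ((r * exp 1) ^ k / fact k)) sums (s powr s * exp (- r) * exp (r * exp 1))"
    using sums_mult[OF exp_converges[of "r * exp 1"], of "s powr s * exp (- r)"]
    by (simp add: divide_inverse mult_ac)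
  have "(\<integral>\<^sup>+\<omega>. ennreal (enn2real (Y \<omega>) powr s) \<partial>M) =
      (\<Sum>k. ennreal (enn2real (of_nat k) powr s) * ennreal (?w k))"
    by (rule int[of "\<lambda>y. ennreal (enn2real y powr s)"])
  also have "\<dots> \<le> (\<Sum>k. ennreal (s powr s * exp (- r) * ((r * exp 1) ^ k / fact k)))"
  proof (intro suminf_le summableI)
    fix k
    have "real k powr s * ?w k \<le> s powr s * exp 1 ^ k * ?w k"
      using r(2) by (intro mult_right_mono bound) auto
    also have "\<dots> = s powr s * exp (- r) * ((r * exp 1) ^ k / fact k)"
      by (simp add: power_mult_distrib)
    finally show "ennreal (enn2real (of_nat k) powr s) * ennreal (?w k) \<le>
        ennreal (s powr s * exp (- r) * ((r * exp 1) ^ k / fact k))"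
      using r(2) by (simp add: ennreal_mult[symmetric] ennreal_of_nat_eq_real_of_nat)
  qed
  also have "\<dots> = ennreal (s powr s * exp (- r) * exp (r * exp 1))"
    using sums r(2) by (intro suminf_ennreal_eq) auto
  finally show "(\<integral>\<^sup>+\<omega>. ennreal (enn2real (Y \<omega>) powr s) \<partial>M) < \<infinity>"
    by (simp add: order_le_less_trans)
  have "(\<integral>\<^sup>+\<omega>. (if Y \<omega> = \<infinity> then 1 else 0) \<partial>M) = 0"
    by (subst int[of "\<lambda>y. if y = \<infinity> then 1 else 0"]) simp
  then show "AE \<omega> in M. Y \<omega> < \<infinity>"
    by (subst (asm) nn_integral_0_iff_AE) (auto simp: less_top split: if_splits)
qed

section \<open>The Poisson random measure and its points\<close>

lemma measurable_pair_countable_snd: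
  fixes f :: "'a \<times> 'i::countable \<Rightarrow> 'b"
  assumes "\<And>i. (\<lambda>x. f (x, i)) \<in> M \<rightarrow>\<^sub>M K"
  shows "f \<in> M \<Otimes>\<^sub>M count_space UNIV \<rightarrow>\<^sub>M K"
proof -
  have "(\<lambda>z. f (fst z, i)) \<in> M \<Otimes>\<^sub>M count_space UNIV \<rightarrow>\<^sub>M K" for i
    using measurable_compose[OF measurable_fst assms] .
  then have "(\<lambda>z. f (fst z, snd z)) \<in> M \<Otimes>\<^sub>M count_space UNIV \<rightarrow>\<^sub>M K"
    by (rule measurable_compose_countable) simp
  then show ?thesis by simp
qed

text \<open>The sets of the refinement are the atoms of the algebra generated by \<open>I\<close>: one for each choice of
  the members of \<open>I\<close> that contain the point.\<close>

lemma finite_disjoint_refinement: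
  assumes I: "finite I" "I \<subseteq> sets S"
  obtains A :: "nat \<Rightarrow> 'a set" and n
  where "A ` {..<n} \<subseteq> sets S" "disjoint_family_on A {..<n}"
    "\<And>C. C \<in> I \<Longrightarrow> C = (\<Union>i\<in>{i. i < n \<and> A i \<subseteq> C}. A i)"
proof -
  define atom where "atom J = {x \<in> space S. \<forall>C\<in>I. x \<in> C \<longleftrightarrow> C \<in> J}" for J
  obtain e where e: "bij_betw e {..<card (Pow I)} (Pow I)"
    using ex_bij_betw_nat_finite[of "Pow I"] I(1) by (auto simp: atLeast0LessThan)
  let ?A = "\<lambda>i. atom (e i)" and ?n = "card (Pow I)"
  show ?thesis
  proof
    have "atom J \<in> sets S" for J
      unfolding atom_def
    proof (rule sets.sets_Collect_finite_All)
      fix C assume "C \<in> I"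
      then have [measurable]: "C \<in> sets S" using I by auto
      show "{x \<in> space S. x \<in> C \<longleftrightarrow> C \<in> J} \<in> sets S" by measurable
    qed (rule I)
    then show "?A ` {..<?n} \<subseteq> sets S" by blast
    have "atom J \<inter> atom J' = {}" if "J \<subseteq> I" "J' \<subseteq> I" "J \<noteq> J'" for J J'
      using that by (auto simp: atom_def)
    moreover have "e i \<subseteq> I" if "i < ?n" for i
      using bij_betwE[OF e] that by auto
    moreover have "e i \<noteq> e j" if "i < ?n" "j < ?n" "i \<noteq> j" for i j
      using inj_onD[OF bij_betw_imp_inj_on[OF e], of i j] that by auto
    ultimately show "disjoint_family_on ?A {..<?n}"
      unfolding disjoint_family_on_def by auto
    fix C assume C: "C \<in> I"
    show "C = (\<Union>i\<in>{i. i < ?n \<and> ?A i \<subseteq> C}. ?A i)"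
    proof (intro equalityI subsetI)
      fix x assume x: "x \<in> C"
      let ?J = "{C\<in>I. x \<in> C}"
      have "?J \<in> e ` {..<?n}"
        using e by (auto simp: bij_betw_def)
      then obtain i where i: "i < ?n" "e i = ?J" by auto
      have "C \<in> sets S" using C I(2) by auto
      then have "x \<in> space S" using x sets.sets_into_space by auto
      then have "x \<in> ?A i"
        by (simp add: atom_def i(2))
      moreover have "?A i \<subseteq> C"
        using C x by (auto simp: atom_def i(2))
      ultimately show "x \<in> (\<Union>i\<in>{i. i < ?n \<and> ?A i \<subseteq> C}. ?A i)"
        using i(1) by blast
    qed auto
  qed
qed

locale poisson_points = prob_space M + complete_measure M + mu: sigma_finite_measure \<mu>
  for M :: "'w measure" and \<mu> :: "'e measure" +
  fixes N :: "'w \<Rightarrow> 'e measure" and X :: "nat \<Rightarrow> 'w \<Rightarrow> 'e"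
  assumes prm: "poisson_random_measure M \<mu> N" and repr: "point_representation M \<mu> N X"
begin

abbreviation charged :: "'w \<Rightarrow> nat \<Rightarrow> bool" where
  "charged \<omega> n \<equiv> of_nat n < emeasure (N \<omega>) (space \<mu>)"

text \<open>The exceptional set of the representation by points is independent of the sets that are measured,
  so that it is a single null set; it is measurable by completeness.\<close>

definition represented :: "'w set" where
  "represented = {\<omega> \<in> space M. \<forall>A\<in>sets \<mu>. emeasure (N \<omega>) A =
     (\<Sum>n. if charged \<omega> n then indicator A (X n \<omega>) else 0)}"

text \<open>The pairs \<open>(\<omega>, n)\<close> for which \<open>X n \<omega>\<close> is a point of \<open>N \<omega>\<close>. Integrals over \<open>points\<close> are expectations of sums
  over the points of \<open>N\<close>. A density on a product of two \<open>\<sigma>\<close>-finite measures gives access to Fubini's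
  theorem, which would not apply to the kernel \<open>\<omega> \<mapsto> N \<omega>\<close> directly.\<close>

definition points :: "('w \<times> nat) measure" where
  "points = density (M \<Otimes>\<^sub>M count_space UNIV) (\<lambda>(\<omega>, n). ennreal (of_bool (charged \<omega> n)))"

text \<open>The default value \<open>N \<omega>\<close> keeps the map measurable into the space of counting measures.\<close>

definition others :: "'w \<Rightarrow> nat \<Rightarrow> 'e measure" where
  "others \<omega> n =
    (if \<omega> \<in> represented \<and> charged \<omega> n then remove_point \<mu> (N \<omega>) (X n \<omega>) else N \<omega>)"

lemma measurable_N [measurable]: "N \<in> M \<rightarrow>\<^sub>M counting_measures \<mu>"
  by (rule prm[unfolded poisson_random_measure_def, THEN conjunct1])

lemma poisson_law_N:
  "A \<in> sets \<mu> \<Longrightarrow> poisson_law M (\<lambda>\<omega>. emeasure (N \<omega>) A) (emeasure \<mu> A)"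
  by (rule prm[unfolded poisson_random_measure_def, THEN conjunct2, THEN conjunct1, rule_format])

lemma indep_N:
  fixes C :: "nat \<Rightarrow> 'e set"
  shows "C ` {..<n} \<subseteq> sets \<mu> \<Longrightarrow> disjoint_family_on C {..<n} \<Longrightarrow>
    indep_vars (\<lambda>_. borel) (\<lambda>i \<omega>. emeasure (N \<omega>) (C i)) {..<n}"
  by (rule prm[unfolded poisson_random_measure_def, THEN conjunct2, THEN conjunct2, rule_format])

lemma measurable_X [measurable]: "X n \<in> M \<rightarrow>\<^sub>M \<mu>"
  using repr by (auto simp: point_representation_def)

lemma measurable_N_emeasure [measurable]:
  "A \<in> sets \<mu> \<Longrightarrow> (\<lambda>\<omega>. emeasure (N \<omega>) A) \<in> borel_measurable M"
  by (rule measurable_compose[OF measurable_N measurable_emeasure_counting_measures])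

lemma N_in_space: "\<omega> \<in> space M \<Longrightarrow> N \<omega> \<in> space (counting_measures \<mu>)"
  using measurable_space[OF measurable_N] .

lemma AE_represented: "AE \<omega> in M. \<omega> \<in> represented"
proof -
  have "AE \<omega> in M. \<forall>A\<in>sets \<mu>. emeasure (N \<omega>) A =
      (\<Sum>n. if of_nat n < emeasure (N \<omega>) (space \<mu>) then emeasure (return \<mu> (X n \<omega>)) A else 0)"
    using repr by (auto simp: point_representation_def)
  then show ?thesis
    using AE_space
  proof eventually_elim
    case (elim \<omega>)
    have "emeasure (N \<omega>) A = (\<Sum>n. if charged \<omega> n then indicator A (X n \<omega>) else 0)"
      if A: "A \<in> sets \<mu>" for A
      using elim(1)[rule_format, OF A] by (simp only: emeasure_return[OF A])
    with elim(2) show ?case unfolding represented_def by blast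
  qed
qed

lemma represented_in_space: "\<omega> \<in> represented \<Longrightarrow> \<omega> \<in> space M"
  by (simp add: represented_def)

lemma sets_represented [measurable]: "represented \<in> sets M"
proof (rule in_sets_AE[OF _ sets.top])
  show "AE \<omega> in M. \<omega> \<in> space M \<longleftrightarrow> \<omega> \<in> represented"
    using AE_represented AE_space by eventually_elim simp
qed (auto intro: represented_in_space)

lemma emeasure_N_represented:
  assumes "\<omega> \<in> represented" "A \<in> sets \<mu>"
  shows "emeasure (N \<omega>) A = (\<Sum>n. if charged \<omega> n then indicator A (X n \<omega>) else 0)"
  using assms unfolding represented_def by blast

lemma indicator_le_N:
  assumes "\<omega> \<in> represented" "charged \<omega> n" "A \<in> sets \<mu>"
  shows "indicator A (X n \<omega>) \<le> emeasure (N \<omega>) A"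
  unfolding emeasure_N_represented[OF assms(1,3)]
  using sum_le_suminf[of "\<lambda>n. if charged \<omega> n then indicator A (X n \<omega>) else 0 :: ennreal" "{n}"] assms(2)
  by auto

lemma emeasure_others:
  assumes "\<omega> \<in> represented" "charged \<omega> n" "A \<in> sets \<mu>"
  shows "emeasure (others \<omega> n) A = emeasure (N \<omega>) A - indicator A (X n \<omega>)"
  using assms N_in_space[OF represented_in_space[OF assms(1)]] indicator_le_N[OF assms(1,2)]
  by (simp add: others_def emeasure_remove_point)

lemma others_in_space: "\<omega> \<in> space M \<Longrightarrow> others \<omega> n \<in> space (counting_measures \<mu>)"
  using indicator_le_N
  by (auto simp: others_def N_in_space intro!: remove_point_in_counting_measures)

lemma add_point_others:
  assumes "\<omega> \<in> represented" "charged \<omega> n"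
  shows "add_point \<mu> (others \<omega> n) (X n \<omega>) = N \<omega>"
  using assms N_in_space[OF represented_in_space[OF assms(1)]] indicator_le_N[OF assms(1,2)]
  by (simp add: others_def add_point_remove_point)

text \<open>For a point of \<open>N \<omega>\<close> the removal subtracts an indicator of \<open>X n \<omega>\<close> from every mass, which is measurable
  in \<open>\<omega>\<close> for each fixed \<open>n\<close>.\<close>

lemma measurable_others_X [measurable]:
  "(\<lambda>(\<omega>, n). (others \<omega> n, X n \<omega>)) \<in> M \<Otimes>\<^sub>M count_space UNIV \<rightarrow>\<^sub>M counting_measures \<mu> \<Otimes>\<^sub>M \<mu>"
proof (rule measurable_pair_countable_snd)
  fix n
  have [measurable]: "(\<lambda>\<omega>. others \<omega> n) \<in> M \<rightarrow>\<^sub>M counting_measures \<mu>"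
  proof (rule measurable_counting_measures[OF others_in_space])
    fix A assume [measurable]: "A \<in> sets \<mu>"
    have "(\<lambda>\<omega>. if \<omega> \<in> represented \<and> charged \<omega> n then emeasure (N \<omega>) A - indicator A (X n \<omega>)
        else emeasure (N \<omega>) A) \<in> borel_measurable M"
      by measurable
    then show "(\<lambda>\<omega>. emeasure (others \<omega> n) A) \<in> borel_measurable M"
      by (rule measurable_cong[THEN iffD1, rotated]) (auto simp: emeasure_others, auto simp: others_def)
  qed
  have "(\<lambda>\<omega>. (others \<omega> n, X n \<omega>)) \<in> M \<rightarrow>\<^sub>M counting_measures \<mu> \<Otimes>\<^sub>M \<mu>"
    by measurable
  then show "(\<lambda>\<omega>. case (\<omega>, n) of (\<omega>, n) \<Rightarrow> (others \<omega> n, X n \<omega>)) \<in> M \<rightarrow>\<^sub>M counting_measures \<mu> \<Otimes>\<^sub>M \<mu>"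
    by simp
qed

lemma measurable_charged [measurable]:
  "(\<lambda>(\<omega>, n). of_bool (charged \<omega> n) :: real) \<in> borel_measurable (M \<Otimes>\<^sub>M count_space UNIV)"
  by (rule measurable_pair_countable_snd) (simp add: of_bool_def)

lemma sets_points [measurable_cong]: "sets points = sets (M \<Otimes>\<^sub>M count_space UNIV)"
  by (simp add: points_def)

lemma nn_integral_points:
  assumes [measurable]: "g \<in> borel_measurable (M \<Otimes>\<^sub>M count_space UNIV)"
  shows "(\<integral>\<^sup>+z. g z \<partial>points) = (\<integral>\<^sup>+\<omega>. (\<Sum>n. if charged \<omega> n then g (\<omega>, n) else 0) \<partial>M)"
proof -
  interpret C: sigma_finite_measure "count_space (UNIV :: nat set)"
    by (rule sigma_finite_measure_count_space)
  have "(\<integral>\<^sup>+z. g z \<partial>points) =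
      (\<integral>\<^sup>+z. (\<lambda>(\<omega>, n). ennreal (of_bool (charged \<omega> n))) z * g z \<partial>(M \<Otimes>\<^sub>M count_space UNIV))"
    unfolding points_def by (rule nn_integral_density) measurable
  also have "\<dots> = (\<integral>\<^sup>+\<omega>. \<integral>\<^sup>+n. ennreal (of_bool (charged \<omega> n)) * g (\<omega>, n) \<partial>count_space UNIV \<partial>M)"
    by (subst C.nn_integral_fst[symmetric]) (simp_all add: case_prod_beta)
  also have "\<dots> = (\<integral>\<^sup>+\<omega>. (\<Sum>n. if charged \<omega> n then g (\<omega>, n) else 0) \<partial>M)"
    by (auto simp: nn_integral_count_space_nat intro!: nn_integral_cong suminf_cong)
  finally show ?thesis .
qed

lemma indep_N_nn_integral:
  fixes A :: "nat \<Rightarrow> 'e set"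
  assumes A: "A ` {..<n} \<subseteq> sets \<mu>" "disjoint_family_on A {..<n}"
    and g: "\<And>i. i < n \<Longrightarrow> g i \<in> borel_measurable borel"
  shows "(\<integral>\<^sup>+\<omega>. (\<Prod>i<n. g i (emeasure (N \<omega>) (A i)) :: ennreal) \<partial>M) =
    (\<Prod>i<n. \<integral>\<^sup>+\<omega>. g i (emeasure (N \<omega>) (A i)) \<partial>M)"
  using g by (intro indep_vars_nn_integral indep_vars_compose2[OF indep_N[OF A]]) auto

section \<open>The reduced Mecke equation\<close>

definition reduced_campbell :: "('e measure \<times> 'e) measure" where
  "reduced_campbell = distr points (counting_measures \<mu> \<Otimes>\<^sub>M \<mu>) (\<lambda>(\<omega>, n). (others \<omega> n, X n \<omega>))"

lemma emeasure_reduced_campbell: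
  assumes [measurable]: "H \<in> sets (counting_measures \<mu> \<Otimes>\<^sub>M \<mu>)"
  shows "emeasure reduced_campbell H =
    (\<integral>\<^sup>+\<omega>. (\<Sum>n. if charged \<omega> n then indicator H (others \<omega> n, X n \<omega>) else 0) \<partial>M)"
proof -
  let ?f = "\<lambda>(\<omega>, n). (others \<omega> n, X n \<omega>)"
  have "emeasure reduced_campbell H = (\<integral>\<^sup>+z. indicator H z \<partial>reduced_campbell)"
    by (simp add: reduced_campbell_def)
  also have "\<dots> = (\<integral>\<^sup>+z. indicator H (?f z) \<partial>points)"
    unfolding reduced_campbell_def by (rule nn_integral_distr) measurable
  also have "\<dots> = (\<integral>\<^sup>+\<omega>. (\<Sum>n. if charged \<omega> n then indicator H (?f (\<omega>, n)) else 0) \<partial>M)"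
    by (rule nn_integral_points) measurable
  finally show ?thesis unfolding prod.case .
qed

text \<open>Removing a point of the atom \<open>A j\<close> lowers the mass of \<open>A j\<close> by one and leaves the masses of the other
  atoms unchanged. The sum over the points in \<open>A j\<close> thus turns into a product of functions of the
  independent masses, in which the factor of \<open>A j\<close> is the size-biased one.\<close>

lemma reduced_campbell_rectangle:
  fixes A :: "nat \<Rightarrow> 'e set"
  assumes A: "A ` {..<n} \<subseteq> sets \<mu>" "disjoint_family_on A {..<n}"
    and j: "j < n" "emeasure \<mu> (A j) < \<infinity>"
    and S: "\<And>i. i < n \<Longrightarrow> S i \<in> sets borel"
  shows "emeasure reduced_campbell ({\<eta> \<in> space (counting_measures \<mu>). \<forall>i<n. emeasure \<eta> (A i) \<in> S i} \<times> A j) =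
    emeasure \<mu> (A j) * emeasure M {\<omega> \<in> space M. \<forall>i<n. emeasure (N \<omega>) (A i) \<in> S i}"
proof -
  have A_sets [measurable]: "i < n \<Longrightarrow> A i \<in> sets \<mu>" for i using A by auto
  note S [measurable]
  let ?E = "{\<eta> \<in> space (counting_measures \<mu>). \<forall>i<n. emeasure \<eta> (A i) \<in> S i}"
  have E [measurable]: "?E \<in> sets (counting_measures \<mu>)"
    by measurable
  have [measurable]: "A j \<in> sets \<mu>" using j by auto
  \<comment> \<open>The extra factor \<open>t\<close> for the atom \<open>A j\<close> counts the points in it.\<close>
  define g where "g i t = (if i = j then t * indicator (S j) (t - 1) else indicator (S i) t)"
    for i and t :: ennreal
  have g_meas [measurable]: "i < n \<Longrightarrow> g i \<in> borel_measurable borel" for i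
    using j unfolding g_def by (cases "i = j") auto
  have "emeasure reduced_campbell (?E \<times> A j) =
    (\<integral>\<^sup>+\<omega>. (\<Sum>k. if charged \<omega> k then indicator (?E \<times> A j) (others \<omega> k, X k \<omega>) else 0) \<partial>M)"
    by (rule emeasure_reduced_campbell) measurable
  also have "\<dots> = (\<integral>\<^sup>+\<omega>. (\<Prod>i<n. g i (emeasure (N \<omega>) (A i))) \<partial>M)"
  proof (rule nn_integral_cong_AE, use AE_represented in eventually_elim)
    fix \<omega> assume \<omega>: "\<omega> \<in> represented"
    let ?c = "\<Prod>i<n. if i = j then indicator (S j) (emeasure (N \<omega>) (A j) - 1)
        else indicator (S i) (emeasure (N \<omega>) (A i)) :: ennreal"
    have "indicator (?E \<times> A j) (others \<omega> k, X k \<omega>) = indicator (A j) (X k \<omega>) * ?c"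
      if k: "charged \<omega> k" for k
    proof (cases "X k \<omega> \<in> A j")
      case True
      have "emeasure (others \<omega> k) (A i) = (if i = j then emeasure (N \<omega>) (A j) - 1 else emeasure (N \<omega>) (A i))"
        if i: "i < n" for i
      proof -
        have "i \<noteq> j \<Longrightarrow> X k \<omega> \<notin> A i"
          using A(2) True i j(1) by (auto simp: disjoint_family_on_def)
        then show ?thesis
          using True emeasure_others[OF \<omega> k A_sets[OF i]] by auto
      qed
      then have "(\<forall>i<n. emeasure (others \<omega> k) (A i) \<in> S i) \<longleftrightarrow>
          (\<forall>i<n. if i = j then emeasure (N \<omega>) (A j) - 1 \<in> S j else emeasure (N \<omega>) (A i) \<in> S i)"
        by auto
      moreover have "?c = indicator {\<omega>. \<forall>i<n. if i = j then emeasure (N \<omega>) (A j) - 1 \<in> S j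
          else emeasure (N \<omega>) (A i) \<in> S i} \<omega>"
      proof (cases "\<forall>i<n. if i = j then emeasure (N \<omega>) (A j) - 1 \<in> S j else emeasure (N \<omega>) (A i) \<in> S i")
        case True
        then have "?c = (\<Prod>i<n. 1)"
          by (intro prod.cong) auto
        then show ?thesis using True by simp
      next
        case False
        then obtain i where "i < n"
          "\<not> (if i = j then emeasure (N \<omega>) (A j) - 1 \<in> S j else emeasure (N \<omega>) (A i) \<in> S i)" by blast
        then have "?c = 0"
          by (intro prod_zero bexI[of _ i]) auto
        then show ?thesis using False by auto
      qed
      ultimately show ?thesis
        using True others_in_space[OF represented_in_space[OF \<omega>], of k] by (simp add: indicator_def)
    qed auto
    then have "(\<Sum>k. if charged \<omega> k then indicator (?E \<times> A j) (others \<omega> k, X k \<omega>) else 0) =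
        (\<Sum>k. (if charged \<omega> k then indicator (A j) (X k \<omega>) else 0) * ?c)"
      by (intro suminf_cong) (simp split: if_split)
    also have "\<dots> = emeasure (N \<omega>) (A j) * ?c"
      unfolding ennreal_suminf_multc emeasure_N_represented[OF \<omega> A_sets[OF j(1)], symmetric] ..
    also have "\<dots> = (\<Prod>i<n. if i = j then emeasure (N \<omega>) (A j) else 1) * ?c"
      using j(1) by simp
    also have "\<dots> = (\<Prod>i<n. g i (emeasure (N \<omega>) (A i)))"
      unfolding prod.distrib[symmetric] by (intro prod.cong) (auto simp: g_def)
    finally show "(\<Sum>k. if charged \<omega> k then indicator (?E \<times> A j) (others \<omega> k, X k \<omega>) else 0) =
        (\<Prod>i<n. g i (emeasure (N \<omega>) (A i)))" .
  qed
  also have "\<dots> = (\<Prod>i<n. \<integral>\<^sup>+\<omega>. g i (emeasure (N \<omega>) (A i)) \<partial>M)"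
    by (rule indep_N_nn_integral[OF A]) measurable
  also have "\<dots> = (\<Prod>i<n. (if i = j then emeasure \<mu> (A j) else 1) *
      (\<integral>\<^sup>+\<omega>. indicator (S i) (emeasure (N \<omega>) (A i)) \<partial>M))"
  proof (rule prod.cong, rule refl)
    fix i assume i: "i \<in> {..<n}"
    have ind: "(\<integral>\<^sup>+\<omega>. indicator (S i) (emeasure (N \<omega>) (A i)) \<partial>M) =
        emeasure M {\<omega> \<in> space M. emeasure (N \<omega>) (A i) \<in> S i}"
    proof -
      have [measurable]: "A i \<in> sets \<mu>" "S i \<in> sets borel" using i S by auto
      have "(\<integral>\<^sup>+\<omega>. indicator (S i) (emeasure (N \<omega>) (A i)) \<partial>M) =
          (\<integral>\<^sup>+\<omega>. indicator {\<omega> \<in> space M. emeasure (N \<omega>) (A i) \<in> S i} \<omega> \<partial>M)"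
        by (rule nn_integral_cong) (auto simp: indicator_def)
      then show ?thesis by simp
    qed
    show "(\<integral>\<^sup>+\<omega>. g i (emeasure (N \<omega>) (A i)) \<partial>M) = (if i = j then emeasure \<mu> (A j) else 1) *
      (\<integral>\<^sup>+\<omega>. indicator (S i) (emeasure (N \<omega>) (A i)) \<partial>M)"
    proof (cases "i = j")
      case True
      have "(\<integral>\<^sup>+\<omega>. emeasure (N \<omega>) (A j) * indicator (S j) (emeasure (N \<omega>) (A j) - 1) \<partial>M) =
          emeasure \<mu> (A j) * emeasure M {\<omega> \<in> space M. emeasure (N \<omega>) (A j) \<in> S j}"
        using j S by (intro poisson_law_size_bias poisson_law_N prob_space_axioms) auto
      with True ind show ?thesis by (simp add: g_def)
    qed (simp add: g_def)
  qed
  also have "\<dots> = emeasure \<mu> (A j) * (\<Prod>i<n. \<integral>\<^sup>+\<omega>. indicator (S i) (emeasure (N \<omega>) (A i)) \<partial>M)"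
    unfolding prod.distrib using j(1) by simp
  also have "(\<Prod>i<n. \<integral>\<^sup>+\<omega>. indicator (S i) (emeasure (N \<omega>) (A i)) \<partial>M) =
      (\<integral>\<^sup>+\<omega>. (\<Prod>i<n. indicator (S i) (emeasure (N \<omega>) (A i))) \<partial>M)"
    by (rule indep_N_nn_integral[OF A, symmetric]) measurable
  also have "\<dots> = (\<integral>\<^sup>+\<omega>. indicator {\<omega> \<in> space M. \<forall>i<n. emeasure (N \<omega>) (A i) \<in> S i} \<omega> \<partial>M)"
  proof (rule nn_integral_cong)
    fix \<omega> assume "\<omega> \<in> space M"
    then show "(\<Prod>i<n. indicator (S i) (emeasure (N \<omega>) (A i))) =
        (indicator {\<omega> \<in> space M. \<forall>i<n. emeasure (N \<omega>) (A i) \<in> S i} \<omega> :: ennreal)"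
      by (cases "\<forall>i<n. emeasure (N \<omega>) (A i) \<in> S i") (auto simp: prod_zero_iff indicator_def)
  qed
  also have "\<dots> = emeasure M {\<omega> \<in> space M. \<forall>i<n. emeasure (N \<omega>) (A i) \<in> S i}"
  proof (rule nn_integral_indicator)
    show "{\<omega> \<in> space M. \<forall>i<n. emeasure (N \<omega>) (A i) \<in> S i} \<in> sets M"
      by measurable
  qed
  finally show ?thesis .
qed

end

lemma sets_cylinder:
  assumes "finite I" "I \<subseteq> sets \<mu>" "\<And>C. C \<in> I \<Longrightarrow> S C \<in> sets borel"
  shows "{\<eta> \<in> space (counting_measures \<mu>). \<forall>C\<in>I. emeasure \<eta> C \<in> S C} \<in> sets (counting_measures \<mu>)"
proof (rule sets.sets_Collect_finite_All)
  fix C assume "C \<in> I"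
  with assms have [measurable]: "C \<in> sets \<mu>" "S C \<in> sets borel" by auto
  show "{\<eta> \<in> space (counting_measures \<mu>). emeasure \<eta> C \<in> S C} \<in> sets (counting_measures \<mu>)"
    by measurable
qed (rule assms)

text \<open>A finite measure on the space of counting measures is determined by its finite-dimensional
  distributions. The cylinders are indexed by finite sets of measurable sets rather than by tuples
  because the union of two index sets then describes an intersection.\<close>

lemma measure_eqI_counting_measures:
  assumes sets: "sets P = sets (counting_measures \<mu>)" "sets Q = sets (counting_measures \<mu>)"
    and fin: "emeasure P (space (counting_measures \<mu>)) \<noteq> \<infinity>"
    and eq: "\<And>I S. finite I \<Longrightarrow> I \<subseteq> sets \<mu> \<Longrightarrow> (\<And>C. C \<in> I \<Longrightarrow> S C \<in> sets borel) \<Longrightarrow>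
      emeasure P {\<eta> \<in> space (counting_measures \<mu>). \<forall>C\<in>I. emeasure \<eta> C \<in> S C} =
      emeasure Q {\<eta> \<in> space (counting_measures \<mu>). \<forall>C\<in>I. emeasure \<eta> C \<in> S C}"
  shows "P = Q"
proof -
  let ?\<Omega> = "space (counting_measures \<mu>)"
  let ?cyl = "\<lambda>I S. {\<eta> \<in> ?\<Omega>. \<forall>C\<in>I. emeasure \<eta> C \<in> S C}"
  let ?E = "{?cyl I S |I S. finite I \<and> I \<subseteq> sets \<mu> \<and> (\<forall>C\<in>I. S C \<in> sets borel)}"
  have gen: "sets (counting_measures \<mu>) = sigma_sets ?\<Omega> ?E"
  proof (rule antisym)
    have "{\<eta> \<in> ?\<Omega>. emeasure \<eta> C \<in> T} \<in> ?E" if "C \<in> sets \<mu>" "T \<in> sets borel" for C T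
      using that by (intro CollectI exI[of _ "{C}"] exI[of _ "\<lambda>_. T"]) auto
    then show "sets (counting_measures \<mu>) \<subseteq> sigma_sets ?\<Omega> ?E"
      unfolding sets_counting_measures by (intro sigma_sets_mono') auto
    have "?E \<subseteq> sets (counting_measures \<mu>)"
      using sets_cylinder by blast
    then show "sigma_sets ?\<Omega> ?E \<subseteq> sets (counting_measures \<mu>)"
      by (rule sets.sigma_sets_subset)
  qed
  show ?thesis
  proof (rule measure_eqI_generator_eq[where A = "\<lambda>_. ?\<Omega>" and \<Omega> = ?\<Omega>])
    show "Int_stable ?E"
    proof (rule Int_stableI)
      fix a b assume "a \<in> ?E" "b \<in> ?E"
      then obtain I S J T where a: "a = ?cyl I S" "finite I" "I \<subseteq> sets \<mu>" "\<forall>C\<in>I. S C \<in> sets borel"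
        and b: "b = ?cyl J T" "finite J" "J \<subseteq> sets \<mu>" "\<forall>C\<in>J. T C \<in> sets borel"
        by blast
      let ?U = "\<lambda>C. (if C \<in> I then S C else UNIV) \<inter> (if C \<in> J then T C else UNIV)"
      have "a \<inter> b = ?cyl (I \<union> J) ?U"
        unfolding a(1) b(1) by auto
      then show "a \<inter> b \<in> ?E"
        using a(2-) b(2-) by (intro CollectI exI[of _ "I \<union> J"] exI[of _ ?U]) auto
    qed
    show "range (\<lambda>_. ?\<Omega>) \<subseteq> ?E"
      by (auto intro!: exI[of _ "{}"])
    show "emeasure P a = emeasure Q a" if "a \<in> ?E" for a
      using that eq by blast
  qed (use sets gen fin in auto)
qed

context poisson_points
begin

lemma sets_reduced_campbell [measurable_cong]: "sets reduced_campbell = sets (counting_measures \<mu> \<Otimes>\<^sub>M \<mu>)"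
  by (simp add: reduced_campbell_def)

text \<open>For a fixed set \<open>D\<close> of points, the reduced Campbell measure as a measure of configurations. It is
  finite if \<open>\<mu> D\<close> is, which makes uniqueness theorems applicable.\<close>

definition campbell_on :: "'e set \<Rightarrow> 'e measure measure" where
  "campbell_on D = distr (density reduced_campbell (\<lambda>z. indicator D (snd z))) (counting_measures \<mu>) fst"

lemma sets_campbell_on [measurable_cong]: "sets (campbell_on D) = sets (counting_measures \<mu>)"
  by (simp add: campbell_on_def)

lemma emeasure_campbell_on:
  assumes [measurable]: "D \<in> sets \<mu>" "H \<in> sets (counting_measures \<mu>)"
  shows "emeasure (campbell_on D) H = emeasure reduced_campbell (H \<times> D)"
proof -
  have fst: "fst \<in> density reduced_campbell (\<lambda>z. indicator D (snd z)) \<rightarrow>\<^sub>M counting_measures \<mu>"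
    by measurable
  have sp: "space reduced_campbell = space (counting_measures \<mu>) \<times> space \<mu>"
    using sets_eq_imp_space_eq[OF sets_reduced_campbell] by (simp add: space_pair_measure)
  have "emeasure (campbell_on D) H =
      emeasure (density reduced_campbell (\<lambda>z. indicator D (snd z))) (fst -` H \<inter> space reduced_campbell)"
    unfolding campbell_on_def by (subst emeasure_distr[OF fst]) auto
  also have "fst -` H \<inter> space reduced_campbell = H \<times> space \<mu>"
    using sets.sets_into_space[OF assms(2)] by (auto simp: sp)
  also have "emeasure (density reduced_campbell (\<lambda>z. indicator D (snd z))) (H \<times> space \<mu>) =
      (\<integral>\<^sup>+z. indicator D (snd z) * indicator (H \<times> space \<mu>) z \<partial>reduced_campbell)"
    by (rule emeasure_density) measurable
  also have "\<dots> = (\<integral>\<^sup>+z. indicator (H \<times> D) z \<partial>reduced_campbell)"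
    using sets.sets_into_space[OF assms(1)]
    by (intro nn_integral_cong) (auto simp: sp split: split_indicator)
  also have "\<dots> = emeasure reduced_campbell (H \<times> D)"
    by simp
  finally show ?thesis .
qed

text \<open>Refining \<open>I\<close> together with \<open>D\<close> by disjoint atoms, the cylinder becomes a condition \<open>v \<in> T\<close> on the vector
  \<open>v\<close> of masses of the atoms, and \<open>D\<close> a union of atoms. On products of sets, the law of \<open>v\<close> is known from
  the previous computation; this fixes it on all of the finite product space, so that \<open>T\<close> may be
  arbitrary.\<close>

lemma campbell_on_cylinder:
  assumes I: "finite I" "I \<subseteq> sets \<mu>" and S: "\<And>C. C \<in> I \<Longrightarrow> S C \<in> sets borel"
    and D: "D \<in> sets \<mu>" "emeasure \<mu> D < \<infinity>"
  shows "emeasure (campbell_on D) {\<eta> \<in> space (counting_measures \<mu>). \<forall>C\<in>I. emeasure \<eta> C \<in> S C} =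
    emeasure \<mu> D * emeasure M {\<omega> \<in> space M. \<forall>C\<in>I. emeasure (N \<omega>) C \<in> S C}"
proof -
  let ?\<Omega> = "space (counting_measures \<mu>)"
  obtain A n where A: "A ` {..<n} \<subseteq> sets \<mu>" "disjoint_family_on A {..<n::nat}"
    and refine: "\<And>C. C \<in> insert D I \<Longrightarrow> C = (\<Union>i\<in>{i. i < n \<and> A i \<subseteq> C}. A i)"
    using finite_disjoint_refinement[of "insert D I" \<mu>] I D(1) by auto
  let ?J = "\<lambda>C. {i. i < n \<and> A i \<subseteq> C}"
  let ?P = "PiM {..<n} (\<lambda>_. borel :: ennreal measure)"
  define v where "v \<eta> = (\<lambda>i\<in>{..<n}. emeasure \<eta> (A i))" for \<eta> :: "'e measure"
  have v [measurable]: "v \<in> counting_measures \<mu> \<rightarrow>\<^sub>M ?P"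
    unfolding v_def using A(1) by (intro measurable_restrict measurable_emeasure_counting_measures) auto
  define T where "T = {t \<in> space ?P. \<forall>C\<in>I. (\<Sum>i\<in>?J C. t i) \<in> S C}"
  have T [measurable]: "T \<in> sets ?P"
    unfolding T_def
  proof (rule sets.sets_Collect_finite_All)
    fix C assume "C \<in> I"
    with S have [measurable]: "S C \<in> sets borel" by auto
    show "{t \<in> space ?P. (\<Sum>i\<in>?J C. t i) \<in> S C} \<in> sets ?P"
      by measurable
  qed (rule I)
  have cyl: "(\<forall>C\<in>I. emeasure \<eta> C \<in> S C) \<longleftrightarrow> v \<eta> \<in> T" if \<eta>: "\<eta> \<in> ?\<Omega>" for \<eta>
  proof -
    have "emeasure \<eta> C = (\<Sum>i\<in>?J C. v \<eta> i)" if C: "C \<in> I" for C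
    proof -
      have "emeasure \<eta> (\<Union>i\<in>?J C. A i) = (\<Sum>i\<in>?J C. emeasure \<eta> (A i))"
        using A counting_measuresD(1)[OF \<eta>]
        by (intro sum_emeasure[symmetric]) (auto simp: disjoint_family_on_def)
      also have "\<dots> = (\<Sum>i\<in>?J C. v \<eta> i)"
        by (intro sum.cong) (auto simp: v_def)
      finally show ?thesis
        using refine[of C] C by simp
    qed
    moreover have "v \<eta> \<in> space ?P"
      using measurable_space[OF v \<eta>] .
    ultimately show ?thesis
      by (simp add: T_def)
  qed
  have atom: "emeasure reduced_campbell ((v -` H \<inter> ?\<Omega>) \<times> A j) =
      emeasure \<mu> (A j) * emeasure M {\<omega> \<in> space M. v (N \<omega>) \<in> H}"
    if j: "j \<in> ?J D" and H: "H \<in> sets ?P" for j H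
  proof -
    have Aj [measurable]: "A j \<in> sets \<mu>" using A(1) j by auto
    have fin: "emeasure \<mu> (A j) < \<infinity>"
      using emeasure_mono[of "A j" D \<mu>] D j by (auto intro: le_less_trans)
    have [measurable]: "(\<lambda>\<omega>. v (N \<omega>)) \<in> M \<rightarrow>\<^sub>M ?P"
      by measurable
    let ?L = "distr (campbell_on (A j)) ?P v"
    let ?R = "scale_measure (emeasure \<mu> (A j)) (distr M ?P (\<lambda>\<omega>. v (N \<omega>)))"
    have L: "emeasure ?L H = emeasure reduced_campbell ((v -` H \<inter> ?\<Omega>) \<times> A j)" if "H \<in> sets ?P" for H
    proof -
      have "emeasure ?L H = emeasure (campbell_on (A j)) (v -` H \<inter> ?\<Omega>)"
        using that sets_eq_imp_space_eq[OF sets_campbell_on] by (subst emeasure_distr) auto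
      with that show ?thesis
        by (subst (asm) emeasure_campbell_on) (auto intro: measurable_sets[OF v])
    qed
    have R: "emeasure ?R H = emeasure \<mu> (A j) * emeasure M {\<omega> \<in> space M. v (N \<omega>) \<in> H}"
      if "H \<in> sets ?P" for H
      using that by (simp add: emeasure_distr vimage_def Int_def conj_commute)
    have "?R = ?L"
    proof (rule measure_eqI_PiM_finite[where I = "{..<n}" and M = "\<lambda>_. borel" and A = "\<lambda>_. space ?P"])
      fix B :: "nat \<Rightarrow> ennreal set" assume B: "\<And>i. i \<in> {..<n} \<Longrightarrow> B i \<in> sets borel"
      have BP: "Pi\<^sub>E {..<n} B \<in> sets ?P"
        using B by (intro sets_PiM_I_finite) auto
      have mem: "v \<eta> \<in> Pi\<^sub>E {..<n} B \<longleftrightarrow> (\<forall>i<n. emeasure \<eta> (A i) \<in> B i)" for \<eta>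
        by (auto simp: v_def PiE_iff)
      have "v -` Pi\<^sub>E {..<n} B \<inter> ?\<Omega> = {\<eta> \<in> ?\<Omega>. \<forall>i<n. emeasure \<eta> (A i) \<in> B i}"
        using mem by auto
      then show "emeasure ?R (Pi\<^sub>E {..<n} B) = emeasure ?L (Pi\<^sub>E {..<n} B)"
        unfolding L[OF BP] R[OF BP] mem
        using reduced_campbell_rectangle[OF A _ fin, of B] B j by simp
    next
      show "range (\<lambda>_. space ?P) \<subseteq> prod_algebra {..<n} (\<lambda>_. borel)"
        unfolding space_PiM by (auto intro!: prod_algebraI_finite)
      have "space ?P \<in> sets ?P" by (rule sets.top)
      note R[OF this]
      then show "emeasure ?R (space ?P) \<noteq> \<infinity>"
        using fin by (auto simp: ennreal_mult_eq_top_iff emeasure_eq_measure)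
    qed auto
    with L[OF H] R[OF H] show ?thesis by simp
  qed
  let ?E = "v -` T \<inter> ?\<Omega>"
  have E: "{\<eta> \<in> ?\<Omega>. \<forall>C\<in>I. emeasure \<eta> C \<in> S C} = ?E"
    using cyl by auto
  have E_sets [measurable]: "?E \<in> sets (counting_measures \<mu>)"
    by (rule measurable_sets[OF v T])
  have D_eq: "D = (\<Union>i\<in>?J D. A i)"
    using refine[of D] by simp
  have "emeasure (campbell_on D) ?E = emeasure reduced_campbell (?E \<times> (\<Union>i\<in>?J D. A i))"
    by (subst emeasure_campbell_on[OF D(1) E_sets], subst D_eq) (rule refl)
  also have "?E \<times> (\<Union>i\<in>?J D. A i) = (\<Union>i\<in>?J D. ?E \<times> A i)"
    by auto
  also have "emeasure reduced_campbell (\<Union>i\<in>?J D. ?E \<times> A i) = (\<Sum>i\<in>?J D. emeasure reduced_campbell (?E \<times> A i))"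
    using A E_sets
    by (intro sum_emeasure[symmetric]) (auto simp: disjoint_family_on_def sets_reduced_campbell)
  also have "\<dots> = (\<Sum>i\<in>?J D. emeasure \<mu> (A i) * emeasure M {\<omega> \<in> space M. v (N \<omega>) \<in> T})"
    by (intro sum.cong atom T) auto
  also have "\<dots> = (\<Sum>i\<in>?J D. emeasure \<mu> (A i)) * emeasure M {\<omega> \<in> space M. v (N \<omega>) \<in> T}"
    by (rule sum_distrib_right[symmetric])
  also have "(\<Sum>i\<in>?J D. emeasure \<mu> (A i)) = emeasure \<mu> (\<Union>i\<in>?J D. A i)"
    using A by (intro sum_emeasure) (auto simp: disjoint_family_on_def)
  also have "(\<Union>i\<in>?J D. A i) = D"
    using D_eq by simp
  also have "{\<omega> \<in> space M. v (N \<omega>) \<in> T} = {\<omega> \<in> space M. \<forall>C\<in>I. emeasure (N \<omega>) C \<in> S C}"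
    using cyl N_in_space by auto
  finally show ?thesis
    unfolding E .
qed

text \<open>For sets \<open>D\<close> of finite mass, both measures agree on products with \<open>D\<close> since they agree on cylinders.
  Cutting an arbitrary \<open>D\<close> into countably many pieces of finite mass extends this to the rectangles
  that determine a product measure.\<close>

theorem reduced_mecke: "reduced_campbell = distr M (counting_measures \<mu>) N \<Otimes>\<^sub>M \<mu>"
proof -
  let ?CM = "counting_measures \<mu>"
  let ?law = "distr M ?CM N"
  have fin: "emeasure reduced_campbell (H \<times> D) = emeasure ?law H * emeasure \<mu> D"
    if H: "H \<in> sets ?CM" and D: "D \<in> sets \<mu>" "emeasure \<mu> D < \<infinity>" for H D
  proof -
    have law: "emeasure ?law H = emeasure M {\<omega> \<in> space M. N \<omega> \<in> H}" if "H \<in> sets ?CM" for H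
      using that by (simp add: emeasure_distr vimage_def Int_def conj_commute)
    have "scale_measure (emeasure \<mu> D) ?law = campbell_on D"
    proof (rule measure_eqI_counting_measures)
      fix I and S :: "_ \<Rightarrow> ennreal set"
      assume I: "finite I" "I \<subseteq> sets \<mu>" and S: "\<And>C. C \<in> I \<Longrightarrow> S C \<in> sets borel"
      let ?E = "{\<eta> \<in> space ?CM. \<forall>C\<in>I. emeasure \<eta> C \<in> S C}"
      have "{\<omega> \<in> space M. N \<omega> \<in> ?E} = {\<omega> \<in> space M. \<forall>C\<in>I. emeasure (N \<omega>) C \<in> S C}"
        using N_in_space by auto
      then show "emeasure (scale_measure (emeasure \<mu> D) ?law) ?E = emeasure (campbell_on D) ?E"
        using campbell_on_cylinder[OF I S D] sets_cylinder[OF I S] by (simp add: law)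
    next
      interpret law: prob_space ?law
        by (rule prob_space_distr) measurable
      show "emeasure (scale_measure (emeasure \<mu> D) ?law) (space ?CM) \<noteq> \<infinity>"
        using D(2) law.emeasure_space_1 by (auto simp: ennreal_mult_eq_top_iff)
    qed (simp_all add: sets_campbell_on)
    then have "emeasure (campbell_on D) H = emeasure (scale_measure (emeasure \<mu> D) ?law) H"
      by simp
    then show ?thesis
      by (simp add: emeasure_campbell_on[OF D(1) H] mult.commute)
  qed
  interpret law: prob_space ?law
    by (rule prob_space_distr) measurable
  have "?law \<Otimes>\<^sub>M \<mu> = reduced_campbell"
  proof (rule pair_measure_eqI)
    fix H D assume H: "H \<in> sets ?law" and D: "D \<in> sets \<mu>"
    obtain A :: "nat \<Rightarrow> _" where A: "range A \<subseteq> sets \<mu>" "(\<Union>i. A i) = space \<mu>"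
      "\<And>i. emeasure \<mu> (A i) \<noteq> \<infinity>" "disjoint_family A"
      using mu.sigma_finite_disjoint by blast
    have H': "H \<in> sets ?CM" using H by simp
    let ?B = "\<lambda>i. D \<inter> A i"
    have B: "range ?B \<subseteq> sets \<mu>"
      using A D by auto
    have B_disj: "disjoint_family ?B"
      using A(4) unfolding disjoint_family_on_def by blast
    have B_fin: "emeasure \<mu> (?B i) < \<infinity>" for i
      using emeasure_mono[of "?B i" "A i" \<mu>] A by (auto simp: less_top[symmetric] top_unique)
    have B_D: "(\<Union>i. ?B i) = D"
      using A(2) sets.sets_into_space[OF D] by blast
    have "emeasure ?law H * emeasure \<mu> D = emeasure ?law H * (\<Sum>i. emeasure \<mu> (?B i))"
      using suminf_emeasure[OF B B_disj] B_D by simp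
    also have "\<dots> = (\<Sum>i. emeasure ?law H * emeasure \<mu> (?B i))"
      by simp
    also have "\<dots> = (\<Sum>i. emeasure reduced_campbell (H \<times> ?B i))"
      using B by (intro suminf_cong fin[symmetric] H' B_fin) auto
    also have "\<dots> = emeasure reduced_campbell (\<Union>i. H \<times> ?B i)"
      using B B_disj H' by (intro suminf_emeasure) (auto simp: sets_reduced_campbell disjoint_family_on_def)
    also have "(\<Union>i. H \<times> ?B i) = H \<times> D"
      using B_D by blast
    finally show "emeasure ?law H * emeasure \<mu> D = emeasure reduced_campbell (H \<times> D)" .
  qed (simp_all add: law.sigma_finite_measure_axioms mu.sigma_finite_measure_axioms sets_reduced_campbell cong: sets_pair_measure_cong)
  then show ?thesis ..
qed

end

section \<open>Integrals over the points\<close>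

lemma mult_le_powr_add_powr:
  fixes a b r p :: real
  assumes "0 \<le> a" "0 \<le> b" "1 < r" "1 < p" "1 / r + 1 / p = 1"
  shows "a * b \<le> a powr r + b powr p"
proof -
  have "a * b \<le> a powr r / r + b powr p / p"
    using assms by (intro Youngs_inequality) auto
  also have "\<dots> \<le> a powr r / 1 + b powr p / 1"
    using assms by (intro add_mono divide_left_mono) auto
  finally show ?thesis by simp
qed

lemma singleton_sets_of_measurable_diagonal:
  assumes "measurable_diagonal \<mu>" and x: "x \<in> space \<mu>"
  shows "{x} \<in> sets \<mu>"
proof -
  have "Pair x -` {(x, y) \<in> space \<mu> \<times> space \<mu>. x = y} = {x}"
    using x by auto
  moreover have "Pair x -` {(x, y) \<in> space \<mu> \<times> space \<mu>. x = y} \<in> sets \<mu>"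
    using assms(1) by (intro sets_Pair1) (auto simp: measurable_diagonal_def)
  ultimately show ?thesis by simp
qed

context poisson_points
begin

lemma reduced_mecke_distr:
  "reduced_campbell = distr (M \<Otimes>\<^sub>M \<mu>) (counting_measures \<mu> \<Otimes>\<^sub>M \<mu>) (\<lambda>(\<omega>, x). (N \<omega>, x))"
proof -
  have "distr M (counting_measures \<mu>) N \<Otimes>\<^sub>M distr \<mu> \<mu> (\<lambda>x. x) =
      distr (M \<Otimes>\<^sub>M \<mu>) (counting_measures \<mu> \<Otimes>\<^sub>M \<mu>) (\<lambda>(\<omega>, x). (N \<omega>, x))"
    by (rule pair_measure_distr) (simp_all add: distr_id mu.sigma_finite_measure_axioms)
  then show ?thesis
    by (simp add: reduced_mecke distr_id)
qed

lemma mecke_nn_integral: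
  fixes h :: "'e measure \<times> 'e \<Rightarrow> ennreal"
  assumes [measurable]: "h \<in> borel_measurable (counting_measures \<mu> \<Otimes>\<^sub>M \<mu>)"
  shows "(\<integral>\<^sup>+z. h (N (fst z), snd z) \<partial>(M \<Otimes>\<^sub>M \<mu>)) =
    (\<integral>\<^sup>+\<omega>. (\<Sum>n. if charged \<omega> n then h (others \<omega> n, X n \<omega>) else 0) \<partial>M)"
proof -
  let ?f = "\<lambda>(\<omega>, n). (others \<omega> n, X n \<omega>)"
  have "(\<integral>\<^sup>+z. h (N (fst z), snd z) \<partial>(M \<Otimes>\<^sub>M \<mu>)) = (\<integral>\<^sup>+z. h z \<partial>reduced_campbell)"
    unfolding reduced_mecke_distr by (subst nn_integral_distr) (auto simp: case_prod_beta)
  also have "\<dots> = (\<integral>\<^sup>+z. h (?f z) \<partial>points)"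
    unfolding reduced_campbell_def by (rule nn_integral_distr) measurable
  also have "\<dots> = (\<integral>\<^sup>+\<omega>. (\<Sum>n. if charged \<omega> n then h (?f (\<omega>, n)) else 0) \<partial>M)"
    by (rule nn_integral_points) measurable
  finally show ?thesis unfolding prod.case .
qed

lemma
  fixes h :: "'e measure \<times> 'e \<Rightarrow> 'b::{banach, second_countable_topology}"
  assumes h [measurable]: "h \<in> borel_measurable (counting_measures \<mu> \<Otimes>\<^sub>M \<mu>)"
  shows mecke_integrable:
      "integrable (M \<Otimes>\<^sub>M \<mu>) (\<lambda>z. h (N (fst z), snd z)) \<longleftrightarrow>
       integrable (M \<Otimes>\<^sub>M count_space UNIV)
         (\<lambda>(\<omega>, n). of_bool (charged \<omega> n) *\<^sub>R h (others \<omega> n, X n \<omega>))" (is ?A)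
    and mecke_integral:
      "(\<integral>z. h (N (fst z), snd z) \<partial>(M \<Otimes>\<^sub>M \<mu>)) =
       (\<integral>(\<omega>, n). of_bool (charged \<omega> n) *\<^sub>R h (others \<omega> n, X n \<omega>) \<partial>(M \<Otimes>\<^sub>M count_space UNIV))" (is ?B)
proof -
  let ?f = "\<lambda>(\<omega>, n). (others \<omega> n, X n \<omega>)"
  let ?w = "\<lambda>(\<omega>, n). of_bool (charged \<omega> n) :: real"
  have f [measurable]: "?f \<in> points \<rightarrow>\<^sub>M counting_measures \<mu> \<Otimes>\<^sub>M \<mu>"
    by measurable
  have hf: "(\<lambda>z. h (?f z)) \<in> borel_measurable (M \<Otimes>\<^sub>M count_space UNIV)"
    by measurable
  have pt: "points = density (M \<Otimes>\<^sub>M count_space UNIV) (\<lambda>z. ennreal (?w z))"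
    unfolding points_def by (intro arg_cong2[where f = density] ext refl) auto
  have eq: "(\<lambda>z. ?w z *\<^sub>R h (?f z)) = (\<lambda>(\<omega>, n). of_bool (charged \<omega> n) *\<^sub>R h (others \<omega> n, X n \<omega>))"
    by auto
  have "integrable (M \<Otimes>\<^sub>M \<mu>) (\<lambda>z. h (N (fst z), snd z)) \<longleftrightarrow> integrable reduced_campbell h"
    unfolding reduced_mecke_distr by (subst integrable_distr_eq) (auto simp: case_prod_beta)
  also have "\<dots> \<longleftrightarrow> integrable points (\<lambda>z. h (?f z))"
    unfolding reduced_campbell_def by (rule integrable_distr_eq) measurable
  also have "\<dots> \<longleftrightarrow> integrable (M \<Otimes>\<^sub>M count_space UNIV) (\<lambda>z. ?w z *\<^sub>R h (?f z))"
    unfolding pt by (rule integrable_density[OF hf measurable_charged]) auto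
  finally show ?A unfolding eq .
  have "(\<integral>z. h (N (fst z), snd z) \<partial>(M \<Otimes>\<^sub>M \<mu>)) = integral\<^sup>L reduced_campbell h"
    unfolding reduced_mecke_distr by (subst integral_distr) (auto simp: case_prod_beta)
  also have "\<dots> = (\<integral>z. h (?f z) \<partial>points)"
    unfolding reduced_campbell_def by (rule integral_distr) measurable
  also have "\<dots> = (\<integral>z. ?w z *\<^sub>R h (?f z) \<partial>(M \<Otimes>\<^sub>M count_space UNIV))"
    unfolding pt by (rule integral_density[OF hf measurable_charged]) auto
  finally show ?B unfolding eq .
qed

text \<open>Mecke's equation in its classical form, for integrands \<open>g(N + \<delta>\<^sub>x)\<close> restricted to \<open>x \<in> B\<close>: the sum over the
  points of \<open>N\<close> in \<open>B\<close> has the constant term \<open>g(N)\<close>.\<close>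

lemma mecke_add_point:
  fixes g :: "'e measure \<Rightarrow> ennreal"
  assumes [measurable]: "g \<in> borel_measurable (counting_measures \<mu>)" "B \<in> sets \<mu>"
  shows "(\<integral>\<^sup>+z. indicator B (snd z) * g (add_point \<mu> (N (fst z)) (snd z)) \<partial>(M \<Otimes>\<^sub>M \<mu>)) =
    (\<integral>\<^sup>+\<omega>. emeasure (N \<omega>) B * g (N \<omega>) \<partial>M)"
proof -
  let ?h = "\<lambda>(\<eta>, x). indicator B x * g (add_point \<mu> \<eta> x)"
  have "?h \<in> borel_measurable (counting_measures \<mu> \<Otimes>\<^sub>M \<mu>)"
    by measurable
  from mecke_nn_integral[OF this]
  have "(\<integral>\<^sup>+z. indicator B (snd z) * g (add_point \<mu> (N (fst z)) (snd z)) \<partial>(M \<Otimes>\<^sub>M \<mu>)) =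
      (\<integral>\<^sup>+\<omega>. (\<Sum>n. if charged \<omega> n then ?h (others \<omega> n, X n \<omega>) else 0) \<partial>M)"
    by simp
  also have "\<dots> = (\<integral>\<^sup>+\<omega>. emeasure (N \<omega>) B * g (N \<omega>) \<partial>M)"
  proof (rule nn_integral_cong_AE, use AE_represented in eventually_elim)
    fix \<omega> assume \<omega>: "\<omega> \<in> represented"
    have "(\<Sum>n. if charged \<omega> n then ?h (others \<omega> n, X n \<omega>) else 0) =
        (\<Sum>n. (if charged \<omega> n then indicator B (X n \<omega>) else 0) * g (N \<omega>))"
      using add_point_others[OF \<omega>] by (intro suminf_cong) simp
    also have "\<dots> = emeasure (N \<omega>) B * g (N \<omega>)"
      unfolding ennreal_suminf_multc emeasure_N_represented[OF \<omega> assms(2), symmetric] ..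
    finally show "(\<Sum>n. if charged \<omega> n then ?h (others \<omega> n, X n \<omega>) else 0) = emeasure (N \<omega>) B * g (N \<omega>)" .
  qed
  finally show ?thesis .
qed

lemma N_eq_distr:
  assumes \<omega>: "\<omega> \<in> represented"
  shows "N \<omega> = distr (density (count_space UNIV) (\<lambda>n. ennreal (of_bool (charged \<omega> n)))) \<mu> (\<lambda>n. X n \<omega>)"
    (is "_ = distr ?C \<mu> ?X")
proof (rule measure_eqI)
  have X: "?X \<in> ?C \<rightarrow>\<^sub>M \<mu>"
    using measurable_space[OF measurable_X represented_in_space[OF \<omega>]] by auto
  show sets: "sets (N \<omega>) = sets (distr ?C \<mu> ?X)"
    using counting_measuresD(1)[OF N_in_space[OF represented_in_space[OF \<omega>]]] by simp
  fix A assume "A \<in> sets (N \<omega>)"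
  then have A: "A \<in> sets \<mu>" using sets by simp
  have "emeasure (distr ?C \<mu> ?X) A = emeasure ?C (?X -` A)"
    using emeasure_distr[OF X A] by simp
  also have "\<dots> = (\<integral>\<^sup>+n. ennreal (of_bool (charged \<omega> n)) * indicator (?X -` A) n \<partial>count_space UNIV)"
    by (rule emeasure_density) auto
  also have "\<dots> = (\<Sum>n. if charged \<omega> n then indicator A (X n \<omega>) else 0)"
    by (subst nn_integral_count_space_nat) (auto intro!: suminf_cong simp: indicator_def)
  finally show "emeasure (N \<omega>) A = emeasure (distr ?C \<mu> ?X) A"
    using emeasure_N_represented[OF \<omega> A] by simp
qed

lemma integral_N:
  fixes g :: "'e \<Rightarrow> 'b::{banach, second_countable_topology}"
  assumes \<omega>: "\<omega> \<in> represented" and g: "g \<in> borel_measurable \<mu>"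
  shows "integral\<^sup>L (N \<omega>) g = (\<integral>n. of_bool (charged \<omega> n) *\<^sub>R g (X n \<omega>) \<partial>count_space UNIV)"
proof -
  let ?C = "density (count_space UNIV) (\<lambda>n. ennreal (of_bool (charged \<omega> n)))"
  have X: "(\<lambda>n. X n \<omega>) \<in> ?C \<rightarrow>\<^sub>M \<mu>"
    using measurable_space[OF measurable_X represented_in_space[OF \<omega>]] by auto
  have "integral\<^sup>L (N \<omega>) g = integral\<^sup>L (distr ?C \<mu> (\<lambda>n. X n \<omega>)) g"
    by (rule arg_cong[OF N_eq_distr[OF \<omega>]])
  also have "\<dots> = (\<integral>n. g (X n \<omega>) \<partial>?C)"
    by (rule integral_distr[OF X g])
  also have "\<dots> = (\<integral>n. of_bool (charged \<omega> n) *\<^sub>R g (X n \<omega>) \<partial>count_space UNIV)"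
    by (rule integral_density) auto
  finally show ?thesis .
qed

text \<open>A Bochner integral needs a measurable integrand, and \<open>x \<mapsto> \<eta> \<setminus> \<delta>\<^sub>x\<close> is given by cases. For
  \<open>\<eta> = N \<omega>\<close> it is constant off the countably many points \<open>X n \<omega>\<close>, and singletons are measurable
  when the diagonal is.\<close>

lemma integral_N_remove_point:
  fixes \<phi> :: "'e measure \<times> 'e \<Rightarrow> 'b::{banach, second_countable_topology}"
  assumes diag: "measurable_diagonal \<mu>" and \<omega>: "\<omega> \<in> represented"
    and \<phi> [measurable]: "\<phi> \<in> borel_measurable (counting_measures \<mu> \<Otimes>\<^sub>M \<mu>)"
  shows "(\<integral>x. \<phi> (remove_point \<mu> (N \<omega>) x, x) \<partial>N \<omega>) =
    (\<integral>n. of_bool (charged \<omega> n) *\<^sub>R \<phi> (others \<omega> n, X n \<omega>) \<partial>count_space UNIV)"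
proof -
  note sp = represented_in_space[OF \<omega>]
  have [measurable]: "N \<omega> \<in> space (counting_measures \<mu>)"
    using N_in_space[OF sp] .
  have "(\<lambda>x. \<phi> (remove_point \<mu> (N \<omega>) x, x)) \<in> borel_measurable \<mu>"
  proof (rule measurable_discrete_difference[where X = "range (\<lambda>n. X n \<omega>)"])
    show "(\<lambda>x. \<phi> (N \<omega>, x)) \<in> borel_measurable \<mu>"
      by measurable
    show "{x} \<in> sets \<mu>" if "x \<in> range (\<lambda>n. X n \<omega>)" for x
      using that measurable_space[OF measurable_X sp]
      by (auto intro!: singleton_sets_of_measurable_diagonal[OF diag])
    fix x assume x: "x \<in> space \<mu>" "x \<notin> range (\<lambda>n. X n \<omega>)"
    have sing: "{x} \<in> sets \<mu>"
      by (rule singleton_sets_of_measurable_diagonal[OF diag x(1)])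
    have "X n \<omega> \<noteq> x" for n
      using x(2) by auto
    then have "emeasure (N \<omega>) {x} = (\<Sum>n. if charged \<omega> n then 0 else 0)"
      unfolding emeasure_N_represented[OF \<omega> sing] by (intro suminf_cong) auto
    then have "\<not> emeasure (return \<mu> x) {x} \<le> emeasure (N \<omega>) {x}"
      using sing by simp
    then have "remove_point \<mu> (N \<omega>) x = N \<omega>"
      using sing unfolding remove_point_def by auto
    then show "\<phi> (N \<omega>, x) = \<phi> (remove_point \<mu> (N \<omega>) x, x)"
      by simp
  qed auto
  from integral_N[OF \<omega> this] show ?thesis
    using \<omega> by (auto intro!: Bochner_Integration.integral_cong simp: others_def)
qed

lemma integrable_norm_mult_supported:
  fixes u :: "'w \<times> 'e \<Rightarrow> 'b::{banach, second_countable_topology}"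
    and \<Phi> :: "'w \<times> 'e \<Rightarrow> 'h::{banach, second_countable_topology}"
  assumes rp: "1 < r" "1 < p" "1 / r + 1 / p = 1"
    and [measurable]: "u \<in> borel_measurable (M \<Otimes>\<^sub>M \<mu>)" "\<Phi> \<in> borel_measurable (M \<Otimes>\<^sub>M \<mu>)" "B \<in> sets \<mu>"
    and supp: "AE z in M \<Otimes>\<^sub>M \<mu>. snd z \<notin> B \<longrightarrow> \<Phi> z = 0"
    and u: "(\<integral>\<^sup>+z. indicator B (snd z) * ennreal (norm (u z) powr r) \<partial>(M \<Otimes>\<^sub>M \<mu>)) < \<infinity>"
    and \<Phi>: "(\<integral>\<^sup>+z. ennreal (norm (\<Phi> z) powr p) \<partial>(M \<Otimes>\<^sub>M \<mu>)) < \<infinity>"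
  shows "integrable (M \<Otimes>\<^sub>M \<mu>) (\<lambda>z. norm (u z) * norm (\<Phi> z))"
proof (rule integrableI_bounded)
  have "(\<integral>\<^sup>+z. ennreal (norm (norm (u z) * norm (\<Phi> z))) \<partial>(M \<Otimes>\<^sub>M \<mu>)) \<le>
      (\<integral>\<^sup>+z. indicator B (snd z) * ennreal (norm (u z) powr r) + ennreal (norm (\<Phi> z) powr p) \<partial>(M \<Otimes>\<^sub>M \<mu>))"
  proof (rule nn_integral_mono_AE, use supp in eventually_elim)
    fix z assume z: "snd z \<notin> B \<longrightarrow> \<Phi> z = 0"
    show "ennreal (norm (norm (u z) * norm (\<Phi> z))) \<le>
        indicator B (snd z) * ennreal (norm (u z) powr r) + ennreal (norm (\<Phi> z) powr p)"
    proof (cases "snd z \<in> B")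
      case True
      have "norm (u z) * norm (\<Phi> z) \<le> norm (u z) powr r + norm (\<Phi> z) powr p"
        by (rule mult_le_powr_add_powr[OF _ _ rp]) auto
      then show ?thesis using True by (simp add: ennreal_plus[symmetric] del: ennreal_plus)
    qed (use z in simp)
  qed
  also have "\<dots> < \<infinity>"
    using u \<Phi> by (subst nn_integral_add) auto
  finally show "(\<integral>\<^sup>+z. ennreal (norm (norm (u z) * norm (\<Phi> z))) \<partial>(M \<Otimes>\<^sub>M \<mu>)) < \<infinity>" .
qed measurable

text \<open>Shifting by a point costs integrability: Mecke's equation produces a factor \<open>N(B)\<close>, which is absorbed
  by passing from the exponent \<open>t\<close> to a smaller exponent \<open>r\<close>.\<close>

lemma nn_integral_add_point_powr_finite:
  fixes f :: "'e measure \<Rightarrow> 'h::real_normed_vector" and r t :: real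
  assumes rt: "0 < r" "r < t"
    and [measurable]: "f \<in> borel_measurable (counting_measures \<mu>)"
    and B: "B \<in> sets \<mu>" "emeasure \<mu> B < \<infinity>"
    and f: "(\<integral>\<^sup>+\<omega>. ennreal (norm (f (N \<omega>)) powr t) \<partial>M) < \<infinity>"
  shows "(\<integral>\<^sup>+z. indicator B (snd z) * ennreal (norm (f (add_point \<mu> (N (fst z)) (snd z))) powr r)
    \<partial>(M \<Otimes>\<^sub>M \<mu>)) < \<infinity>"
proof -
  note [measurable] = B(1)
  \<comment> \<open>\<open>s\<close> is the exponent conjugate to \<open>t / r\<close>: it splits \<open>N(B) \<parallel>F\<parallel>\<^sup>r\<close> into \<open>\<parallel>F\<parallel>\<^sup>t\<close> and a moment of \<open>N(B)\<close>.\<close>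
  define s where "s = t / (t - r)"
  have s: "1 < s" "1 < t / r" "1 / (t / r) + 1 / s = 1"
    using rt by (auto simp: s_def field_simps)
  then have "0 < s" by simp
  note moments = poisson_law_finite_moments[OF prob_space_axioms measurable_N_emeasure[OF B(1)]
      poisson_law_N[OF B(1)] B(2) this]
  have "(\<integral>\<^sup>+z. indicator B (snd z) * ennreal (norm (f (add_point \<mu> (N (fst z)) (snd z))) powr r) \<partial>(M \<Otimes>\<^sub>M \<mu>)) =
      (\<integral>\<^sup>+\<omega>. emeasure (N \<omega>) B * ennreal (norm (f (N \<omega>)) powr r) \<partial>M)"
    by (rule mecke_add_point) measurable
  also have "\<dots> \<le> (\<integral>\<^sup>+\<omega>. ennreal (norm (f (N \<omega>)) powr t) + ennreal (enn2real (emeasure (N \<omega>) B) powr s) \<partial>M)"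
  proof (rule nn_integral_mono_AE)
    show "AE \<omega> in M. emeasure (N \<omega>) B * ennreal (norm (f (N \<omega>)) powr r) \<le>
        ennreal (norm (f (N \<omega>)) powr t) + ennreal (enn2real (emeasure (N \<omega>) B) powr s)"
      using moments(2)
    proof (eventually_elim)
      case (elim \<omega>)
      let ?y = "enn2real (emeasure (N \<omega>) B)" and ?a = "norm (f (N \<omega>))"
      have "?a powr r * ?y \<le> (?a powr r) powr (t / r) + ?y powr s"
        using s by (intro mult_le_powr_add_powr) auto
      also have "(?a powr r) powr (t / r) = ?a powr t"
        using rt by (simp add: powr_powr)
      finally have "ennreal (?a powr r * ?y) \<le> ennreal (?a powr t + ?y powr s)"
        by (rule ennreal_leI)
      moreover have "emeasure (N \<omega>) B = ennreal ?y"
        using elim by simp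
      ultimately show ?case
        by (simp add: ennreal_mult mult.commute)
    qed
  qed
  also have "\<dots> < \<infinity>"
    using f moments(1) by (subst nn_integral_add) auto
  finally show ?thesis .
qed

end

section \<open>Duality\<close>

lemma (in complete_measure) measurable_AE_eq:
  assumes f: "f \<in> M \<rightarrow>\<^sub>M borel" and eq: "AE x in M. f x = g x"
  shows "g \<in> M \<rightarrow>\<^sub>M borel"
proof (rule measurableI)
  fix A :: "'b set" assume "A \<in> sets borel"
  then have A: "f -` A \<inter> space M \<in> sets M"
    by (rule measurable_sets[OF f])
  have "AE x in M. x \<in> f -` A \<inter> space M \<longleftrightarrow> x \<in> g -` A \<inter> space M"
    using eq by eventually_elim auto
  then show "g -` A \<inter> space M \<in> sets M"
    by (rule in_sets_AE[OF _ A]) auto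
qed simp

lemma powr_le_one_add_powr:
  fixes a r p :: real
  assumes "0 \<le> a" "0 \<le> r" "r \<le> p"
  shows "a powr r \<le> 1 + a powr p"
proof (cases "a \<le> 1")
  case True
  then have "a powr r \<le> 1" using assms by (intro powr_le1) auto
  with powr_ge_zero[of a p] show ?thesis by linarith
next
  case False
  then have "a powr r \<le> a powr p" using assms by (intro powr_mono) auto
  then show ?thesis by simp
qed

text \<open>On a set of finite measure, integrability of some order, or boundedness, gives integrability of
  every smaller order.\<close>

lemma Lp_supported_nn_integral_powr:
  fixes f :: "'a \<Rightarrow> 'h::{real_normed_vector, second_countable_topology}"
  assumes f: "f \<in> Lp p S" and r: "0 < r" "ennreal r < p"
    and A [measurable]: "A \<in> sets S" and fin: "emeasure S A < \<infinity>"
    and supp: "AE x in S. x \<notin> A \<longrightarrow> f x = 0"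
  shows "(\<integral>\<^sup>+x. ennreal (norm (f x) powr r) \<partial>S) < \<infinity>"
proof (cases "p = \<infinity>")
  case True
  then obtain C where C: "AE x in S. norm (f x) \<le> C"
    using f by (auto simp: Lp_def)
  have "(\<integral>\<^sup>+x. ennreal (norm (f x) powr r) \<partial>S) \<le> (\<integral>\<^sup>+x. ennreal (C powr r) * indicator A x \<partial>S)"
  proof (rule nn_integral_mono_AE, use C supp in eventually_elim)
    fix x assume "norm (f x) \<le> C" "x \<notin> A \<longrightarrow> f x = 0"
    then show "ennreal (norm (f x) powr r) \<le> ennreal (C powr r) * indicator A x"
      using r(1) powr_mono2[of r "norm (f x)" C] by (cases "x \<in> A") (simp_all add: ennreal_leI)
  qed
  also have "\<dots> = ennreal (C powr r) * emeasure S A"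
    by (rule nn_integral_cmult_indicator) measurable
  also have "\<dots> < \<infinity>"
    using fin by (simp add: ennreal_mult_less_top)
  finally show ?thesis .
next
  case False
  then obtain p' where p': "p = ennreal p'" "0 \<le> p'" by (cases p) auto
  then have rp: "r < p'" using r by (simp add: ennreal_less_iff)
  have [measurable]: "f \<in> borel_measurable S"
    and int: "(\<integral>\<^sup>+x. ennreal (norm (f x) powr p') \<partial>S) < \<infinity>"
    using f p' False by (auto simp: Lp_def)
  have "(\<integral>\<^sup>+x. ennreal (norm (f x) powr r) \<partial>S) \<le>
      (\<integral>\<^sup>+x. indicator A x + ennreal (norm (f x) powr p') \<partial>S)"
  proof (rule nn_integral_mono_AE, use supp in eventually_elim)
    fix x assume x: "x \<notin> A \<longrightarrow> f x = 0"
    have "ennreal (norm (f x) powr r) \<le> ennreal (1 + norm (f x) powr p')"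
      using r(1) rp by (intro ennreal_leI powr_le_one_add_powr) auto
    then show "ennreal (norm (f x) powr r) \<le> indicator A x + ennreal (norm (f x) powr p')"
      using x by (cases "x \<in> A") auto
  qed
  also have "\<dots> = emeasure S A + (\<integral>\<^sup>+x. ennreal (norm (f x) powr p') \<partial>S)"
    by (subst nn_integral_add) auto
  also have "\<dots> < \<infinity>"
    using fin int by simp
  finally show ?thesis .
qed

text \<open>The exponents \<open>s\<close> and \<open>t\<close> replace \<open>p\<close> and \<open>q / (q - 1)\<close>. Being finite and greater than one, they avoid the
  cases \<open>p = \<infinity>\<close> and \<open>q = 1\<close>.\<close>

lemma conjugate_exponents_between:
  fixes p q :: ennreal
  assumes "1 \<le> q" "q < p"
  obtains r s t :: real where "1 < r" "1 < s" "1 / r + 1 / s = 1" "r < t"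
    "ennreal s < p" "ennreal t < q / (q - 1)"
proof -
  obtain m where m: "q < m" "m < p" using dense[OF assms(2)] by blast
  obtain m' where m': "m < m'" "m' < p" using dense[OF m(2)] by blast
  obtain a where a: "q = ennreal a" "0 \<le> a" using m by (cases q) auto
  obtain b where b: "m = ennreal b" "0 \<le> b" using m' by (cases m) auto
  obtain s where s: "m' = ennreal s" "0 \<le> s" using m' by (cases m') auto
  have "1 \<le> a" "a < b" "b < s"
    using assms(1) m m' a b s by (auto simp: ennreal_less_iff)
  show ?thesis
  proof
    \<comment> \<open>For \<open>q < b < s < p\<close>, the conjugates of \<open>s\<close> and \<open>b\<close> lie in the opposite order below that of \<open>q\<close>.\<close>
    show "1 < s / (s - 1)" "1 < s" "1 / (s / (s - 1)) + 1 / s = 1" "s / (s - 1) < b / (b - 1)"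
      using \<open>1 \<le> a\<close> \<open>a < b\<close> \<open>b < s\<close> by (auto simp: field_simps)
    show "ennreal s < p" using m' s by simp
    show "ennreal (b / (b - 1)) < q / (q - 1)"
    proof (cases "a = 1")
      case True
      then show ?thesis by (simp add: a)
    next
      case False
      then have a1: "1 < a" using \<open>1 \<le> a\<close> by simp
      have "q / (q - 1) = ennreal a / ennreal (a - 1)"
        using a1 by (simp add: a ennreal_minus flip: ennreal_1)
      also have "\<dots> = ennreal (a / (a - 1))"
        using a1 by (intro divide_ennreal) auto
      also have "b / (b - 1) < a / (a - 1)"
        using a1 \<open>a < b\<close> by (simp add: field_simps)
      then have "ennreal (b / (b - 1)) < ennreal (a / (a - 1))"
        using a1 by (intro ennreal_lessI) auto
      finally show ?thesis .
    qed
  qed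
qed

text \<open>The computation with fixed representatives \<open>f\<close> and \<open>\<phi>\<close>. The terms \<open>f(N + \<delta>\<^sub>x)\<close> and \<open>f(N)\<close> are integrated
  separately against \<open>\<Phi>\<close>; the first one is transformed by Mecke's equation.\<close>

lemma (in poisson_points) pathwise_duality:
  fixes f :: "'e measure \<Rightarrow> 'h::{real_inner, banach, second_countable_topology}"
    and \<phi> :: "'e measure \<times> 'e \<Rightarrow> 'h" and r p t :: real
  assumes diag: "measurable_diagonal \<mu>"
    and rp: "1 < r" "1 < p" "1 / r + 1 / p = 1" and rt: "r < t"
    and f [measurable]: "f \<in> borel_measurable (counting_measures \<mu>)"
    and F [measurable]: "F \<in> borel_measurable M" and F_eq: "AE \<omega> in M. F \<omega> = f (N \<omega>)"
    and \<phi> [measurable]: "\<phi> \<in> borel_measurable (counting_measures \<mu> \<Otimes>\<^sub>M \<mu>)"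
    and \<Phi> [measurable]: "\<Phi> \<in> borel_measurable (M \<Otimes>\<^sub>M \<mu>)"
    and \<Phi>_eq: "AE z in M \<Otimes>\<^sub>M \<mu>. \<Phi> z = \<phi> (N (fst z), snd z)"
    and B: "B \<in> sets \<mu>" "emeasure \<mu> B < \<infinity>"
    and supp: "AE z in M \<Otimes>\<^sub>M \<mu>. snd z \<notin> B \<longrightarrow> \<Phi> z = 0"
    and F_int: "(\<integral>\<^sup>+\<omega>. ennreal (norm (F \<omega>) powr t) \<partial>M) < \<infinity>"
    and \<Phi>_int: "(\<integral>\<^sup>+z. ennreal (norm (\<Phi> z) powr p) \<partial>(M \<Otimes>\<^sub>M \<mu>)) < \<infinity>"
  defines "\<delta> \<omega> \<equiv> (LINT x|N \<omega>. \<phi> (remove_point \<mu> (N \<omega>) x, x)) - (LINT x|\<mu>. \<Phi> (\<omega>, x))"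
    and "DF z \<equiv> f (add_point \<mu> (N (fst z)) (snd z)) - f (N (fst z))"
  shows "integrable M (\<lambda>\<omega>. F \<omega> \<bullet> \<delta> \<omega>)"
    and "integrable (M \<Otimes>\<^sub>M \<mu>) (\<lambda>z. DF z \<bullet> \<Phi> z)"
    and "(LINT \<omega>|M. F \<omega> \<bullet> \<delta> \<omega>) = (LINT \<omega>|M. (LINT x:B|\<mu>. DF (\<omega>, x) \<bullet> \<Phi> (\<omega>, x)))"
proof -
  interpret P: pair_sigma_finite M \<mu> ..
  interpret C: sigma_finite_measure "count_space (UNIV :: nat set)"
    by (rule sigma_finite_measure_count_space)
  interpret PC: pair_sigma_finite M "count_space (UNIV :: nat set)" ..
  note [measurable] = B(1)
  let ?MM = "M \<Otimes>\<^sub>M \<mu>" and ?MC = "M \<Otimes>\<^sub>M count_space (UNIV :: nat set)"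
  define fa where "fa z = f (add_point \<mu> (N (fst z)) (snd z))" for z
  define fn where "fn z = f (N (fst z))" for z :: "'w \<times> 'e"
  define h where "h = (\<lambda>(\<eta>, x). f (add_point \<mu> \<eta> x) \<bullet> \<phi> (\<eta>, x))"
  have fa [measurable]: "fa \<in> borel_measurable ?MM"
    unfolding fa_def[abs_def] by measurable
  have fn [measurable]: "fn \<in> borel_measurable ?MM"
    unfolding fn_def[abs_def] by measurable
  have h [measurable]: "h \<in> borel_measurable (counting_measures \<mu> \<Otimes>\<^sub>M \<mu>)"
    unfolding h_def by measurable
  have F_eq': "AE z in ?MM. F (fst z) = fn z"
    unfolding fn_def by (rule AE_pair_measureI_fst[OF mu.sigma_finite_measure_axioms F_eq])

  have f_int: "(\<integral>\<^sup>+\<omega>. ennreal (norm (f (N \<omega>)) powr t) \<partial>M) < \<infinity>"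
  proof -
    have "(\<integral>\<^sup>+\<omega>. ennreal (norm (f (N \<omega>)) powr t) \<partial>M) = (\<integral>\<^sup>+\<omega>. ennreal (norm (F \<omega>) powr t) \<partial>M)"
      using F_eq by (intro nn_integral_cong_AE) auto
    with F_int show ?thesis by simp
  qed
  have fa_int: "(\<integral>\<^sup>+z. indicator B (snd z) * ennreal (norm (fa z) powr r) \<partial>?MM) < \<infinity>"
    unfolding fa_def using rp rt f_int B by (intro nn_integral_add_point_powr_finite[where t = t]) auto
  have fn_int: "(\<integral>\<^sup>+z. indicator B (snd z) * ennreal (norm (fn z) powr r) \<partial>?MM) < \<infinity>"
  proof -
    have "(\<integral>\<^sup>+z. indicator B (snd z) * ennreal (norm (fn z) powr r) \<partial>?MM) =
        (\<integral>\<^sup>+\<omega>. \<integral>\<^sup>+x. ennreal (norm (f (N \<omega>)) powr r) * indicator B x \<partial>\<mu> \<partial>M)"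
      by (subst mu.nn_integral_fst[symmetric]) (simp_all add: fn_def mult.commute)
    also have "\<dots> = (\<integral>\<^sup>+\<omega>. emeasure \<mu> B * ennreal (norm (f (N \<omega>)) powr r) \<partial>M)"
      by (intro nn_integral_cong) (subst nn_integral_cmult_indicator[OF B(1)], rule mult.commute)
    also have "\<dots> = emeasure \<mu> B * (\<integral>\<^sup>+\<omega>. ennreal (norm (f (N \<omega>)) powr r) \<partial>M)"
      by (rule nn_integral_cmult) measurable
    also have "(\<integral>\<^sup>+\<omega>. ennreal (norm (f (N \<omega>)) powr r) \<partial>M) \<le>
        (\<integral>\<^sup>+\<omega>. 1 + ennreal (norm (f (N \<omega>)) powr t) \<partial>M)"
    proof (rule nn_integral_mono)
      fix \<omega>
      have "ennreal (norm (f (N \<omega>)) powr r) \<le> ennreal (1 + norm (f (N \<omega>)) powr t)"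
        using rp(1) rt by (intro ennreal_leI powr_le_one_add_powr) auto
      then show "ennreal (norm (f (N \<omega>)) powr r) \<le> 1 + ennreal (norm (f (N \<omega>)) powr t)"
        by simp
    qed
    also have "(\<integral>\<^sup>+\<omega>. 1 + ennreal (norm (f (N \<omega>)) powr t) \<partial>M) =
        1 + (\<integral>\<^sup>+\<omega>. ennreal (norm (f (N \<omega>)) powr t) \<partial>M)"
      by (subst nn_integral_add) (auto simp: emeasure_space_1)
    finally have "(\<integral>\<^sup>+z. indicator B (snd z) * ennreal (norm (fn z) powr r) \<partial>?MM) \<le>
        emeasure \<mu> B * (1 + (\<integral>\<^sup>+\<omega>. ennreal (norm (f (N \<omega>)) powr t) \<partial>M))"
      by (simp add: mult_left_mono)
    also have "\<dots> < \<infinity>"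
      using f_int B(2) by (simp add: ennreal_mult_less_top)
    finally show ?thesis .
  qed
  have one_int: "(\<integral>\<^sup>+z. indicator B (snd z) * ennreal (norm (1 :: real) powr r) \<partial>?MM) < \<infinity>"
  proof -
    have "(\<integral>\<^sup>+z. indicator B (snd z) * ennreal (norm (1 :: real) powr r) \<partial>?MM) =
        (\<integral>\<^sup>+\<omega>. \<integral>\<^sup>+x. indicator B x \<partial>\<mu> \<partial>M)"
      by (subst mu.nn_integral_fst[symmetric]) simp_all
    also have "\<dots> = emeasure \<mu> B"
      by (simp add: emeasure_space_1)
    finally show ?thesis using B(2) by simp
  qed

  note supported = integrable_norm_mult_supported[OF rp _ \<Phi> B(1) supp _ \<Phi>_int]
  have fa\<Phi>: "integrable ?MM (\<lambda>z. fa z \<bullet> \<Phi> z)"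
    by (rule Bochner_Integration.integrable_bound[OF supported[OF fa fa_int]]) (auto simp: Cauchy_Schwarz_ineq2)
  have fn\<Phi>: "integrable ?MM (\<lambda>z. fn z \<bullet> \<Phi> z)"
    by (rule Bochner_Integration.integrable_bound[OF supported[OF fn fn_int]]) (auto simp: Cauchy_Schwarz_ineq2)
  have F\<Phi>: "integrable ?MM (\<lambda>z. F (fst z) \<bullet> \<Phi> z)"
    by (rule integrable_cong_AE_imp[OF fn\<Phi>]) (use F_eq' in auto)
  have \<Phi>_integrable: "integrable ?MM \<Phi>"
    by (rule Bochner_Integration.integrable_bound[OF supported[OF _ one_int]]) auto
  have DF\<Phi>: "DF z \<bullet> \<Phi> z = fa z \<bullet> \<Phi> z - fn z \<bullet> \<Phi> z" for z
    by (simp add: DF_def fa_def fn_def inner_diff_left)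
  show DF_int: "integrable ?MM (\<lambda>z. DF z \<bullet> \<Phi> z)"
    unfolding DF\<Phi> by (rule Bochner_Integration.integrable_diff[OF fa\<Phi> fn\<Phi>])

  let ?G = "\<lambda>(\<omega>, n). of_bool (charged \<omega> n) *\<^sub>R h (others \<omega> n, X n \<omega>)"
  let ?g = "\<lambda>(\<omega>, n). of_bool (charged \<omega> n) *\<^sub>R \<phi> (others \<omega> n, X n \<omega>)"
  have h_eq: "AE z in ?MM. fa z \<bullet> \<Phi> z = h (N (fst z), snd z)"
    using \<Phi>_eq by eventually_elim (simp add: h_def fa_def)
  have G_int: "integrable ?MC ?G"
    using integrable_cong_AE_imp[OF fa\<Phi> _ h_eq] by (subst mecke_integrable[OF h, symmetric]) simp
  have g_int: "integrable ?MC ?g"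
    using integrable_cong_AE_imp[OF \<Phi>_integrable _ \<Phi>_eq] by (subst mecke_integrable[OF \<phi>, symmetric]) simp

  \<comment> \<open>\<open>?K\<close> is built from iterated integrals, hence measurable; \<open>\<delta>\<close> agrees with it only almost surely.\<close>
  let ?K = "\<lambda>\<omega>. (\<integral>n. ?G (\<omega>, n) \<partial>count_space UNIV) - (\<integral>x. F \<omega> \<bullet> \<Phi> (\<omega>, x) \<partial>\<mu>)"
  have K_int1: "integrable M (\<lambda>\<omega>. \<integral>n. ?G (\<omega>, n) \<partial>count_space UNIV)"
    by (rule PC.integrable_fst'[OF G_int])
  have K_int2: "integrable M (\<lambda>\<omega>. \<integral>x. F \<omega> \<bullet> \<Phi> (\<omega>, x) \<partial>\<mu>)"
    using P.integrable_fst'[OF F\<Phi>] by simp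
  have K: "AE \<omega> in M. ?K \<omega> = F \<omega> \<bullet> \<delta> \<omega>"
    using AE_represented F_eq PC.AE_integrable_fst'[OF g_int] P.AE_integrable_fst'[OF \<Phi>_integrable]
  proof eventually_elim
    case (elim \<omega>)
    have "F \<omega> \<bullet> \<delta> \<omega> = F \<omega> \<bullet> (\<integral>n. ?g (\<omega>, n) \<partial>count_space UNIV) - F \<omega> \<bullet> (\<integral>x. \<Phi> (\<omega>, x) \<partial>\<mu>)"
      unfolding \<delta>_def integral_N_remove_point[OF diag elim(1) \<phi>] by (simp add: inner_diff_right)
    also have "F \<omega> \<bullet> (\<integral>x. \<Phi> (\<omega>, x) \<partial>\<mu>) = (\<integral>x. F \<omega> \<bullet> \<Phi> (\<omega>, x) \<partial>\<mu>)"
      using elim(4) by simp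
    also have "F \<omega> \<bullet> (\<integral>n. ?g (\<omega>, n) \<partial>count_space UNIV) = (\<integral>n. F \<omega> \<bullet> ?g (\<omega>, n) \<partial>count_space UNIV)"
      by (rule integral_inner_right[symmetric]) (rule elim(3))
    also have "\<dots> = (\<integral>n. ?G (\<omega>, n) \<partial>count_space UNIV)"
      using add_point_others[OF elim(1)] elim(2)
      by (intro Bochner_Integration.integral_cong) (auto simp: h_def)
    finally show ?case ..
  qed
  have \<delta>_meas: "(\<lambda>\<omega>. F \<omega> \<bullet> \<delta> \<omega>) \<in> borel_measurable M"
    by (rule measurable_AE_eq[OF _ K]) (use K_int1 K_int2 in auto)
  show "integrable M (\<lambda>\<omega>. F \<omega> \<bullet> \<delta> \<omega>)"
    by (rule integrable_cong_AE_imp[OF _ \<delta>_meas K]) (rule Bochner_Integration.integrable_diff[OF K_int1 K_int2])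

  have "(LINT \<omega>|M. F \<omega> \<bullet> \<delta> \<omega>) = (LINT \<omega>|M. ?K \<omega>)"
    using K K_int1 K_int2 \<delta>_meas by (intro integral_cong_AE) auto
  also have "\<dots> = (LINT \<omega>|M. \<integral>n. ?G (\<omega>, n) \<partial>count_space UNIV) - (LINT \<omega>|M. \<integral>x. F \<omega> \<bullet> \<Phi> (\<omega>, x) \<partial>\<mu>)"
    by (rule Bochner_Integration.integral_diff[OF K_int1 K_int2])
  also have "(LINT \<omega>|M. \<integral>n. ?G (\<omega>, n) \<partial>count_space UNIV) = integral\<^sup>L ?MC ?G"
    by (rule PC.integral_fst'[OF G_int])
  also have "\<dots> = (\<integral>z. h (N (fst z), snd z) \<partial>?MM)"
    by (rule mecke_integral[OF h, symmetric])
  also have "\<dots> = (\<integral>z. fa z \<bullet> \<Phi> z \<partial>?MM)"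
    using h_eq by (intro integral_cong_AE) auto
  also have "(LINT \<omega>|M. \<integral>x. F \<omega> \<bullet> \<Phi> (\<omega>, x) \<partial>\<mu>) = (\<integral>z. F (fst z) \<bullet> \<Phi> z \<partial>?MM)"
    using P.integral_fst'[OF F\<Phi>] by simp
  also have "\<dots> = (\<integral>z. fn z \<bullet> \<Phi> z \<partial>?MM)"
    using F_eq' by (intro integral_cong_AE) auto
  also have "(\<integral>z. fa z \<bullet> \<Phi> z \<partial>?MM) - (\<integral>z. fn z \<bullet> \<Phi> z \<partial>?MM) = (\<integral>z. DF z \<bullet> \<Phi> z \<partial>?MM)"
    unfolding DF\<Phi> by (rule Bochner_Integration.integral_diff[OF fa\<Phi> fn\<Phi>, symmetric])
  also have "\<dots> = (\<integral>z. indicator B (snd z) *\<^sub>R (DF z \<bullet> \<Phi> z) \<partial>?MM)"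
  proof (rule integral_cong_AE)
    show "AE z in ?MM. DF z \<bullet> \<Phi> z = indicator B (snd z) *\<^sub>R (DF z \<bullet> \<Phi> z)"
      using supp by eventually_elim (auto simp: indicator_def)
  qed (use DF_int in measurable)
  also have "\<dots> = (LINT \<omega>|M. (LINT x:B|\<mu>. DF (\<omega>, x) \<bullet> \<Phi> (\<omega>, x)))"
  proof -
    have "integrable ?MM (\<lambda>z. indicator B (snd z) *\<^sub>R (DF z \<bullet> \<Phi> z))"
      by (rule Bochner_Integration.integrable_bound[OF DF_int]) (use DF_int in \<open>auto simp: indicator_def\<close>)
    from P.integral_fst'[OF this] show ?thesis
      by (simp add: set_lebesgue_integral_def)
  qed
  finally show "(LINT \<omega>|M. F \<omega> \<bullet> \<delta> \<omega>) = (LINT \<omega>|M. (LINT x:B|\<mu>. DF (\<omega>, x) \<bullet> \<Phi> (\<omega>, x)))" .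
qed

theorem lemma3p18:
  fixes M :: "'w measure" and \<mu> :: "'e measure"
    and N :: "'w \<Rightarrow> 'e measure" and X :: "nat \<Rightarrow> 'w \<Rightarrow> 'e"
    and p q :: ennreal and B :: "'e set"
    and \<Phi> :: "'w \<times> 'e \<Rightarrow> 'h::{real_inner, banach, second_countable_topology}"
    and F :: "'w \<Rightarrow> 'h"
  assumes "sigma_finite_measure \<mu>" and "measurable_diagonal \<mu>"
    and "prob_space M" and "complete_measure M"
    and "poisson_random_measure M \<mu> N" and "point_representation M \<mu> N X"
    and "completely_generated_by M \<mu> N"
    and "1 \<le> q" and "q < p"
    and "\<Phi> \<in> Lp p (M \<Otimes>\<^sub>M \<mu>)"
    and "B \<in> sets \<mu>" and "emeasure \<mu> B < \<infinity>"
    and "AE (\<omega>, x) in M \<Otimes>\<^sub>M \<mu>. x \<notin> B \<longrightarrow> \<Phi> (\<omega>, x) = 0"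
    and "F \<in> Lp (q / (q - 1)) M"
  shows "integrable M (\<lambda>\<omega>. F \<omega> \<bullet> kabanov_skorohod M \<mu> N \<Phi> \<omega>) \<and>
         integrable (M \<Otimes>\<^sub>M \<mu>) (\<lambda>(\<omega>, x). difference M \<mu> N F (\<omega>, x) \<bullet> \<Phi> (\<omega>, x)) \<and>
         (LINT \<omega>|M. F \<omega> \<bullet> kabanov_skorohod M \<mu> N \<Phi> \<omega>) =
         (LINT \<omega>|M. (LINT x:B|\<mu>. difference M \<mu> N F (\<omega>, x) \<bullet> \<Phi> (\<omega>, x)))"
proof -
  interpret prob_space M by fact
  interpret complete_measure M by fact
  interpret mu: sigma_finite_measure \<mu> by fact
  interpret poisson_points M \<mu> N X
    by unfold_locales (fact assms)+
  have F: "F \<in> borel_measurable M" and \<Phi>: "\<Phi> \<in> borel_measurable (M \<Otimes>\<^sub>M \<mu>)"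
    using assms(10,14) by (auto simp: Lp_def)
  have supp: "AE z in M \<Otimes>\<^sub>M \<mu>. snd z \<notin> B \<longrightarrow> \<Phi> z = 0"
    using assms(13) by (simp add: case_prod_beta)

  define f where "f = (SOME f. f \<in> borel_measurable (counting_measures \<mu>) \<and> (AE \<omega> in M. F \<omega> = f (N \<omega>)))"
  have "\<exists>f. f \<in> borel_measurable (counting_measures \<mu>) \<and> (AE \<omega> in M. F \<omega> = f (N \<omega>))"
    using borel_measurable_AE_factor[OF completely_generated_sets[OF assms(7) measurable_N] F] by blast
  from someI_ex[OF this] have f: "f \<in> borel_measurable (counting_measures \<mu>)" "AE \<omega> in M. F \<omega> = f (N \<omega>)"
    unfolding f_def by auto

  define \<phi> where "\<phi> = (SOME \<phi>. \<phi> \<in> borel_measurable (counting_measures \<mu> \<Otimes>\<^sub>M \<mu>) \<and>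
    (AE (\<omega>, x) in M \<Otimes>\<^sub>M \<mu>. \<Phi> (\<omega>, x) = \<phi> (N \<omega>, x)))"
  have "\<exists>\<phi>\<in>borel_measurable (counting_measures \<mu> \<Otimes>\<^sub>M \<mu>). AE z in M \<Otimes>\<^sub>M \<mu>. \<Phi> z = \<phi> (N (fst z), snd z)"
    by (rule borel_measurable_AE_factor[OF completely_generated_pair_sets[OF assms(7) measurable_N assms(1)] \<Phi>])
  then have "\<exists>\<phi>. \<phi> \<in> borel_measurable (counting_measures \<mu> \<Otimes>\<^sub>M \<mu>) \<and>
      (AE (\<omega>, x) in M \<Otimes>\<^sub>M \<mu>. \<Phi> (\<omega>, x) = \<phi> (N \<omega>, x))"
    unfolding case_prod_beta prod.collapse by blast
  from someI_ex[OF this] have \<phi>: "\<phi> \<in> borel_measurable (counting_measures \<mu> \<Otimes>\<^sub>M \<mu>)"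
    "AE z in M \<Otimes>\<^sub>M \<mu>. \<Phi> z = \<phi> (N (fst z), snd z)"
    unfolding \<phi>_def[symmetric] by (simp_all add: case_prod_beta)

  obtain r s t :: real where rs: "1 < r" "1 < s" "1 / r + 1 / s = 1" and rt: "r < t"
    and s: "ennreal s < p" and t: "ennreal t < q / (q - 1)"
    using conjugate_exponents_between[OF assms(8,9)] by blast
  have \<Phi>_int: "(\<integral>\<^sup>+z. ennreal (norm (\<Phi> z) powr s) \<partial>(M \<Otimes>\<^sub>M \<mu>)) < \<infinity>"
  proof (rule Lp_supported_nn_integral_powr[OF assms(10) _ s])
    show "space M \<times> B \<in> sets (M \<Otimes>\<^sub>M \<mu>)" "0 < s"
      using assms(11) rs by auto
    show "emeasure (M \<Otimes>\<^sub>M \<mu>) (space M \<times> B) < \<infinity>"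
      using assms(11,12) by (simp add: mu.emeasure_pair_measure_Times emeasure_space_1)
    show "AE z in M \<Otimes>\<^sub>M \<mu>. z \<notin> space M \<times> B \<longrightarrow> \<Phi> z = 0"
      using supp AE_space by eventually_elim (auto simp: space_pair_measure)
  qed
  have F_int: "(\<integral>\<^sup>+\<omega>. ennreal (norm (F \<omega>) powr t) \<partial>M) < \<infinity>"
    using rs rt by (intro Lp_supported_nn_integral_powr[OF assms(14) _ t, of "space M"])
      (auto simp: emeasure_space_1)

  note duality = pathwise_duality[OF assms(2) rs rt f(1) F f(2) \<phi>(1) \<Phi> \<phi>(2) assms(11,12) supp F_int \<Phi>_int]
  have \<delta>: "kabanov_skorohod M \<mu> N \<Phi> \<omega> =
      (LINT x|N \<omega>. \<phi> (remove_point \<mu> (N \<omega>) x, x)) - (LINT x|\<mu>. \<Phi> (\<omega>, x))" for \<omega>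
    by (simp add: kabanov_skorohod_def eps_minus_def \<phi>_def Let_def)
  have D: "difference M \<mu> N F z = f (add_point \<mu> (N (fst z)) (snd z)) - f (N (fst z))" for z
    by (simp add: difference_def f_def Let_def case_prod_beta)
  show ?thesis
    using duality by (simp add: \<delta> D case_prod_unfold)
qed

end
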